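(* Let $n\ge 3$ and suppose $K<0$. Let $\varphi$ be a solution to the ODE $$K\varphi^{n-2}=-\varphi''(1-\varphi'^2)^{\frac{n-3}{2}},$$ with integration constant $C_K$. Then: (1) The inverse function of $\varphi$ is given by $$t-t_0=\int_{\varphi(t_0)}^{\varphi(t)}\pm\frac{d\varphi}{\sqrt{1-(K\varphi^{n-1}-C_K)^{\frac{2}{n-1}}}},$$ where $t_0$ is a fixed initial time. (2) When $C_K\neq -1$, $\varphi$ can be defined on $[C',C'+T]\cup[D'-T,D']$, where $C',D'$ are two real numbers such that $\varphi(C')=\varphi(D')=\left(\frac{C_K}{K}\right)^{\frac{1}{n-1}}$, where $$D'-C'=2\int_{\left(\frac{C_K+1}{K}\right)^{\frac{1}{n-1}}}^{\left(\frac{C_K}{K}\right)^{\frac{1}{n-1}}}\frac{d\varphi}{\sqrt{1-(K\varphi^{n-1}-C_K)^{\frac{2}{n-1}}}},$$ and $$T=T(C_K)=\int_{\left(\max\{0,\frac{C_K+1}{K}\}\right)^{\frac{1}{n-1}}}^{\left(\frac{C_K}{K}\right)^{\frac{1}{n-1}}}\frac{d\varphi}{\sqrt{1-(K\varphi^{n-1}-C_K)^{\frac{2}{n-1}}}}.$$ In this case, the sign of the integrand in (1) is $-$ in the interval $[C',C'+T]$ and $+$ in the interval $[D'-T,D']$, or the other way around if the orientation of the generating curve is reversed. (3) When $C_K=-1$, fix the sign of the integrand in (1) to be positive. Under this convention, the interval of definition of the solution $\varphi$ to the ODE extends to $-\infty$. In particular, the corresponding hypersurface is non-compact and unbounded in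 the $x_n$-direction.
   Context: Here $\varphi\ge 0$ is the radius function of the arclength-parametrized generating curve $(x_1,x_n)=(\varphi(t),\psi(t))$ of a rotational hypersurface in $\mathbb{R}^n$ (rotation around the $x_n$-axis), with $\varphi'^2+\psi'^2=1$ and $\psi'\ge0$. The corresponding hypersurface is the one obtained by rotating this curve. The ODE expresses that the hypersurface has constant Gauss-Kronecker curvature $K$ (the product of the principal curvatures). The real constant $C_K$ is the integration constant of the first integral $K\varphi^{n-1}=(1-\varphi'^2)^{\frac{n-1}{2}}+C_K$; for $K<0$ one has $C_K<0$. The sign $\pm$ in the integrand agrees with the sign of $\varphi'$.
   Formalization: The identically zero solution (C_K = −1), for which formula (1) fails, is excluded; for odd n and −1 < C_K < 0 the lower limit in the formula for D'−C' is an even root of a negative number, undefined as written, and is read as minus the root of the absolute value. *)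

theory Defs
  imports "HOL-Analysis.Analysis"
begin

text \<open>
  The set \<open>S\<close> is an interval or a union of two intervals; derivatives at its boundary points
  are one-sided. The functions \<open>\<phi>'\<close> and \<open>\<psi>'\<close> are carried along as the derivatives of \<open>\<phi>\<close> and \<open>\<psi>\<close>.
\<close>

definition generating_curve ::
  "real set \<Rightarrow> (real \<Rightarrow> real) \<Rightarrow> (real \<Rightarrow> real) \<Rightarrow> (real \<Rightarrow> real) \<Rightarrow> (real \<Rightarrow> real) \<Rightarrow> bool"
  where "generating_curve S \<phi> \<phi>' \<psi> \<psi>' \<longleftrightarrow>
    (\<forall>t\<in>S. 0 \<le> \<phi> t
      \<and> (\<phi> has_real_derivative \<phi>' t) (at t within S)
      \<and> (\<psi> has_real_derivative \<psi>' t) (at t within S)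
      \<and> (\<phi>' t)\<^sup>2 + (\<psi>' t)\<^sup>2 = 1
      \<and> 0 \<le> \<psi>' t)"

text \<open>
  For \<open>x \<ge> 0\<close> the power \<open>x\<close> to the \<open>m/2\<close> is written \<open>sqrt x ^ m\<close>, so that the exponent \<open>0\<close>
  (when \<open>n = 3\<close>) gives \<open>1\<close> also at \<open>x = 0\<close>, unlike \<open>powr\<close>.

  The equation is required in the interior only. At a boundary point where \<open>\<phi>'\<^sup>2 = 1\<close> a solution
  has no finite second derivative if \<open>n > 3\<close>, but it is still differentiable there
  in the one-sided sense.
\<close>

definition curvature_ode ::
  "nat \<Rightarrow> real \<Rightarrow> real set \<Rightarrow> (real \<Rightarrow> real) \<Rightarrow> (real \<Rightarrow> real) \<Rightarrow> bool"
  where "curvature_ode n K S \<phi> \<phi>' \<longleftrightarrow>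
    (\<forall>t\<in>interior S. \<exists>\<phi>''.
      (\<phi>' has_real_derivative \<phi>'') (at t)
      \<and> K * \<phi> t ^ (n - 2) = - \<phi>'' * sqrt (1 - (\<phi>' t)\<^sup>2) ^ (n - 3))"

definition first_integral ::
  "nat \<Rightarrow> real \<Rightarrow> real \<Rightarrow> real set \<Rightarrow> (real \<Rightarrow> real) \<Rightarrow> (real \<Rightarrow> real) \<Rightarrow> bool"
  where "first_integral n K C S \<phi> \<phi>' \<longleftrightarrow>
    (\<forall>t\<in>S. K * \<phi> t ^ (n - 1) = sqrt (1 - (\<phi>' t)\<^sup>2) ^ (n - 1) + C)"

definition curvature_solution ::
  "nat \<Rightarrow> real \<Rightarrow> real \<Rightarrow> real set \<Rightarrow> (real \<Rightarrow> real) \<Rightarrow> (real \<Rightarrow> real) \<Rightarrow>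
    (real \<Rightarrow> real) \<Rightarrow> (real \<Rightarrow> real) \<Rightarrow> bool"
  where "curvature_solution n K C S \<phi> \<phi>' \<psi> \<psi>' \<longleftrightarrow>
    generating_curve S \<phi> \<phi>' \<psi> \<psi>' \<and> curvature_ode n K S \<phi> \<phi>' \<and> first_integral n K C S \<phi> \<phi>'"

text \<open>
  \<open>root k\<close> is the real \<open>k\<close>-th root, extended by \<open>root k (- x) = - root k x\<close> (also for even \<open>k\<close>).
\<close>

definition quad_integrand :: "nat \<Rightarrow> real \<Rightarrow> real \<Rightarrow> real \<Rightarrow> real"
  where "quad_integrand n K C y = 1 / sqrt (1 - (root (n - 1) (K * y ^ (n - 1) - C))\<^sup>2)"

text \<open>The sign \<open>\<sigma>\<close> is \<open>1\<close> or \<open>-1\<close>. The integral is oriented: its bounds may come in either order.\<close>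

definition inverse_formula ::
  "nat \<Rightarrow> real \<Rightarrow> real \<Rightarrow> real \<Rightarrow> real set \<Rightarrow> (real \<Rightarrow> real) \<Rightarrow> bool"
  where "inverse_formula n K C \<sigma> J \<phi> \<longleftrightarrow>
    inj_on \<phi> J \<and>
    (\<forall>t\<^sub>0\<in>J. \<forall>t\<in>J.
      interval_lebesgue_integrable lborel (ereal (\<phi> t\<^sub>0)) (ereal (\<phi> t)) (quad_integrand n K C)
      \<and> t - t\<^sub>0 = (LBINT y=ereal (\<phi> t\<^sub>0)..ereal (\<phi> t). \<sigma> * quad_integrand n K C y))"

text \<open>
  At \<open>y = root (n - 1) ((C + 1) / K)\<close> the integrand may have a singularity, so integrability up to
  that bound needs to be stated: the value of a non-integrable \<open>LBINT\<close> is \<open>0\<close>.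
\<close>

definition quad_integrable_between :: "nat \<Rightarrow> real \<Rightarrow> real \<Rightarrow> real \<Rightarrow> real \<Rightarrow> bool"
  where "quad_integrable_between n K C a b \<longleftrightarrow>
    interval_lebesgue_integrable lborel (ereal a) (ereal b) (quad_integrand n K C)"

definition quad_time :: "nat \<Rightarrow> real \<Rightarrow> real \<Rightarrow> real \<Rightarrow> real \<Rightarrow> real"
  where "quad_time n K C a b = (LBINT y=ereal a..ereal b. quad_integrand n K C y)"

text \<open>
  The curve is rotated around the coordinate axis with index \<open>k\<close>: the unit vectors \<open>\<omega>\<close> orthogonal
  to that axis form the sphere of dimension \<open>n - 2\<close> on which the rotations act.
\<close>

definition rotation_hypersurface ::
  "'n::finite \<Rightarrow> real set \<Rightarrow> (real \<Rightarrow> real) \<Rightarrow> (real \<Rightarrow> real) \<Rightarrow> (real ^ 'n) set"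
  where "rotation_hypersurface k S \<phi> \<psi> =
    {\<phi> t *\<^sub>R \<omega> + \<psi> t *\<^sub>R axis k 1 | t \<omega>. t \<in> S \<and> norm \<omega> = 1 \<and> \<omega> $ k = 0}"

end

theory Submission
  imports Defs
begin

text \<open>
  On the curve the first integral reads \<open>\<psi>' = w \<phi>\<close> with
  \<open>w y = root (n - 1) (K * y ^ (n - 1) - C)\<close>, so that \<open>\<phi>' = \<plusminus> sqrt (1 - (w \<phi>)\<^sup>2)\<close>. Hence the
  antiderivative \<open>F\<close> of \<open>1 / sqrt (1 - w\<^sup>2)\<close> turns every monotone piece of \<open>\<phi>\<close> into
  \<open>F (\<phi> t) = \<plusminus> (t - c)\<close>, and the inverse function of \<open>F\<close> extends that piece as far as \<open>F\<close> has
  values. The integrand is singular only where \<open>w = 1\<close>. For \<open>C \<noteq> -1\<close> the singularity is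
  integrable, and for \<open>C < -1\<close> the curve reaches it in finite time, with \<open>\<phi>' = 0\<close>, and continues on the
  reflected branch. For \<open>C = -1\<close> it sits at \<open>y = 0\<close>, where \<open>sqrt (1 - w\<^sup>2)\<close> is at most linear in \<open>y\<close>:
  the integral diverges, and the curve needs infinite time to approach the axis.
\<close>

text \<open>The first integral alone does not determine the curve: for \<open>C < -1\<close> the
  constant radius with \<open>w = 1\<close>, a cylinder, satisfies it too, because
  \<open>sqrt (1 - w\<^sup>2)\<close> is not Lipschitz at its zero. Only the second order equation
  excludes this. It follows that between two zeros of \<open>\<phi>'\<close> the radius would have
  to be constant, so there is at most one turning point, a minimum, and at most two monotone pieces.
  The same zero spoils differentiability: as a function of \<open>y\<close> the speed
  \<open>sqrt (1 - w\<^sup>2)\<close> has infinite slope at a positive radius with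
  \<open>w = 1\<close>. Along the curve the bad factor cancels in the chain rule, and the
  derivatives at the ends of a branch are recovered as limits of those inside. For
  \<open>C > -1\<close> the formula for \<open>D' - C'\<close> integrates down to a negative radius,
  which no curve attains. All that matters about this extra piece is that it is integrable and
  positive: it keeps the two intervals disjoint, as it must, since the branches end on the axis with
  nonzero slopes of opposite sign.\<close>

subsection \<open>Intervals, derivatives and antiderivatives\<close>

lemma is_interval_ivl_subset:
  fixes S :: "real set"
  assumes "is_interval S" "c \<in> S" "d \<in> S"
  shows "{c..d} \<subseteq> S"
  using assms by (meson atLeastAtMost_iff mem_is_interval_1_I subsetI)

lemma is_interval_open_ivl_subset_interior:
  fixes S :: "real set"
  assumes "is_interval S" "c \<in> S" "d \<in> S"
  shows "{c<..<d} \<subseteq> interior S"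
  using is_interval_ivl_subset[OF assms] by (intro interior_maximal) auto

lemma has_real_derivative_within_interval:
  fixes f g :: "real \<Rightarrow> real"
  assumes S: "is_interval S" and f: "continuous_on S f" and g: "continuous_on S g"
    and deriv: "\<And>x. x \<in> interior S \<Longrightarrow> (f has_real_derivative g x) (at x)"
    and x: "x \<in> S"
  shows "(f has_real_derivative g x) (at x within S)"
proof -
  \<comment> \<open>On a side where \<open>S\<close> has points, a point of \<open>S\<close>
    strictly on that side is taken; otherwise \<open>x\<close> itself.\<close>
  obtain c where c: "c \<in> S" "c \<le> x" "c < x \<or> (\<forall>y\<in>S. x \<le> y)"
    using x by (cases "\<exists>y\<in>S. y < x") (auto simp: not_less intro: less_imp_le)
  obtain d where d: "d \<in> S" "x \<le> d" "x < d \<or> (\<forall>y\<in>S. y \<le> x)"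
    using x by (cases "\<exists>y\<in>S. x < y") (auto simp: not_less intro: less_imp_le)
  have sub: "{c..d} \<subseteq> S" and sub': "{c<..<d} \<subseteq> interior S"
    using is_interval_ivl_subset[OF S] is_interval_open_ivl_subset_interior[OF S] c(1) d(1) by auto
  \<comment> \<open>\<open>U\<close> cuts only on the sides where \<open>c\<close> or
    \<open>d\<close> differs from \<open>x\<close>, so inside \<open>U\<close> the sets
    \<open>S\<close> and \<open>{c..d}\<close> agree.\<close>
  define U where "U = (if c < x then {c<..} else UNIV) \<inter> (if x < d then {..<d} else UNIV)"
  have "at x within S = at x within {c..d}"
  proof (rule at_within_nhd)
    show "x \<in> U" "open U"
      using c d by (auto simp: U_def)
    show "S \<inter> U - {x} = {c..d} \<inter> U - {x}"
      using sub c d by (auto simp: U_def intro: antisym)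
  qed
  moreover have "(f has_real_derivative g x) (at x within {c..d})"
  proof (rule has_field_derivative_transform_within[where d = 1])
    show "((\<lambda>u. f c + integral {c..u} g) has_real_derivative g x) (at x within {c..d})"
      using integral_has_real_derivative[of c d g x] c d continuous_on_subset[OF g sub]
      by (auto intro!: derivative_eq_intros)
    fix u assume u: "u \<in> {c..d}"
    have "(g has_integral f u - f c) {c..u}"
    proof (rule fundamental_theorem_of_calculus_interior)
      show "continuous_on {c..u} f"
        using u sub by (intro continuous_on_subset[OF f]) auto
      show "(f has_vector_derivative g y) (at y)" if "y \<in> {c<..<u}" for y
        using deriv[of y] that u sub'
        by (auto simp: has_real_derivative_iff_has_vector_derivative subset_iff)
    qed (use u in auto)
    then show "f c + integral {c..u} g = f u"
      by (simp add: integral_unique)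
  qed (use c d in auto)
  ultimately show ?thesis
    by simp
qed

text \<open>The second point \<open>y\<close> makes \<open>x\<close> a limit point of
  \<open>S\<close>; at an isolated point every \<open>D\<close> would be a derivative.\<close>

lemma mono_on_imp_deriv_within_nonneg:
  fixes f :: "real \<Rightarrow> real"
  assumes mono: "mono_on S f" and S: "is_interval S" and x: "x \<in> S" and y: "y \<in> S" "y \<noteq> x"
    and deriv: "(f has_real_derivative D) (at x within S)"
  shows "0 \<le> D"
proof (rule ccontr)
  assume "\<not> 0 \<le> D"
  then have D: "D < 0" by simp
  show False
  proof (cases "x < y")
    case True
    from has_real_derivative_neg_dec_right[OF deriv D] obtain d where
      d: "d > 0" "\<And>h. h > 0 \<Longrightarrow> x + h \<in> S \<Longrightarrow> h < d \<Longrightarrow> f (x + h) < f x" by blast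
    define h where "h = min (d / 2) (y - x)"
    have h: "0 < h" "h < d" "x + h \<le> y"
      using True d(1) by (auto simp: h_def)
    have "x + h \<in> S"
      using is_interval_ivl_subset[OF S x y(1)] h by auto
    with h d(2)[of h] mono_onD[OF mono x, of "x + h"] show False
      by auto
  next
    case False
    from has_real_derivative_neg_dec_left[OF deriv D] obtain d where
      d: "d > 0" "\<And>h. h > 0 \<Longrightarrow> x - h \<in> S \<Longrightarrow> h < d \<Longrightarrow> f x < f (x - h)" by blast
    define h where "h = min (d / 2) (x - y)"
    have h: "0 < h" "h < d" "y \<le> x - h"
      using False y d(1) by (auto simp: h_def)
    have "x - h \<in> S"
      using is_interval_ivl_subset[OF S y(1) x] h by auto
    with h d(2)[of h] mono_onD[OF mono _ x, of "x - h"] show False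
      by auto
  qed
qed

text \<open>Rolle's theorem yields a zero of \<open>f'\<close> strictly between two points of equal
  value, hence in the interior. A zero at an end of \<open>S\<close> is therefore allowed, as at a
  turning point from which a branch starts.\<close>

lemma nonzero_deriv_imp_inj_on:
  fixes f :: "real \<Rightarrow> real"
  assumes S: "is_interval S" and deriv: "\<And>x. x \<in> S \<Longrightarrow> (f has_real_derivative f' x) (at x within S)"
    and nz: "\<And>x. x \<in> interior S \<Longrightarrow> f' x \<noteq> 0"
  shows "inj_on f S"
proof (rule linorder_inj_onI')
  fix s t assume st: "s \<in> S" "t \<in> S" "s < t"
  have sub: "{s..t} \<subseteq> S" and sub': "{s<..<t} \<subseteq> interior S"
    using is_interval_ivl_subset[OF S] is_interval_open_ivl_subset_interior[OF S] st by auto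
  have cont: "continuous_on {s..t} f"
    using DERIV_continuous_on[OF deriv] sub by (rule continuous_on_subset)
  have at: "DERIV f x :> f' x" if "x \<in> {s<..<t}" for x
  proof -
    have "x \<in> interior S"
      using sub' that by blast
    moreover from this have "x \<in> S"
      using interior_subset by (rule subsetD[rotated])
    ultimately show ?thesis
      using deriv[of x] by (simp add: at_within_interior[of x S])
  qed
  show "f s \<noteq> f t"
  proof
    assume "f s = f t"
    moreover have "f differentiable (at x)" if "s < x" "x < t" for x
      using at[of x] that by (auto simp: real_differentiable_def)
    ultimately obtain z where z: "s < z" "z < t" "DERIV f z :> 0"
      using Rolle[OF st(3) _ cont] by blast
    then have "f' z = 0"
      using DERIV_unique[OF at z(3)] by simp
    moreover have "z \<in> interior S"
      using sub' z by auto
    ultimately show False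
      using nz by blast
  qed
qed

text \<open>Glues the two branches. A point outside a closed set is no limit point of it, so there
  the filter is \<open>bot\<close> and any derivative will do.\<close>

lemma has_real_derivative_within_Un_closed:
  fixes f :: "real \<Rightarrow> real"
  assumes "closed S" "closed T"
    and "x \<in> S \<Longrightarrow> (f has_real_derivative D) (at x within S)"
    and "x \<in> T \<Longrightarrow> (f has_real_derivative D) (at x within T)"
  shows "(f has_real_derivative D) (at x within S \<union> T)"
proof -
  have "(f has_real_derivative D) (at x within U)"
    if "closed U" "x \<in> U \<Longrightarrow> (f has_real_derivative D) (at x within U)" for U
  proof (cases "x \<in> U")
    case False
    with that(1) have "at x within U = bot"
      using closed_limpt trivial_limit_within by blast
    then show ?thesis
      by (simp add: has_field_derivative_iff)
  qed (use that in blast)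
  then show ?thesis
    using assms by (auto simp: has_field_derivative_iff Lim_within_Un)
qed

lemma has_real_derivative_affine_within:
  fixes f g :: "real \<Rightarrow> real"
  assumes f: "(f has_real_derivative d) (at (\<sigma> * (t - c)) within E)" and t: "t \<in> S"
    and g: "\<And>u. u \<in> S \<Longrightarrow> \<sigma> * (u - c) \<in> E \<and> g u = f (\<sigma> * (u - c))"
  shows "(g has_real_derivative \<sigma> * d) (at t within S)"
proof -
  have "((\<lambda>u. \<sigma> * (u - c)) has_real_derivative \<sigma>) (at t within S)"
    by (auto intro!: derivative_eq_intros)
  moreover have "(f has_real_derivative d) (at (\<sigma> * (t - c)) within (\<lambda>u. \<sigma> * (u - c)) ` S)"
    using g by (intro has_field_derivative_subset[OF f]) auto
  ultimately have "((f \<circ> (\<lambda>u. \<sigma> * (u - c))) has_real_derivative d * \<sigma>) (at t within S)"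
    by (intro DERIV_image_chain)
  then have "((f \<circ> (\<lambda>u. \<sigma> * (u - c))) has_real_derivative \<sigma> * d) (at t within S)"
    by (simp only: mult.commute)
  then show ?thesis
    by (rule has_field_derivative_transform_within[where d = 1]) (use g t in auto)
qed

text \<open>Two antiderivatives of \<open>g\<close> differ by a constant on an interval, so a global
  one can be shifted to agree with the given height on \<open>I\<close>.\<close>

lemma antiderivative_extension:
  fixes g \<psi> :: "real \<Rightarrow> real"
  assumes g: "continuous_on UNIV g" and I: "is_interval I"
    and \<psi>: "\<And>t. t \<in> I \<Longrightarrow> (\<psi> has_real_derivative g t) (at t within I)"
  obtains \<Psi> where "\<And>t. (\<Psi> has_real_derivative g t) (at t)" "\<And>t. t \<in> I \<Longrightarrow> \<Psi> t = \<psi> t"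
proof -
  obtain F where F: "\<And>t. (F has_real_derivative g t) (at t)"
    using einterval_antiderivative[of "-\<infinity>" \<infinity> g] g
    by (auto simp: continuous_on_eq_continuous_at has_real_derivative_iff_has_vector_derivative)
  have "((\<lambda>t. \<psi> t - F t) has_real_derivative 0) (at t within I)" if "t \<in> I" for t
    using DERIV_diff[OF \<psi>[OF that] has_field_derivative_at_within[OF F[of t]]] by simp
  with I obtain c where c: "\<And>t. t \<in> I \<Longrightarrow> \<psi> t - F t = c"
    using has_field_derivative_zero_constant[of I "\<lambda>t. \<psi> t - F t"]
    by (auto simp: is_interval_convex_1)
  show ?thesis
  proof
    show "((\<lambda>t. F t + c) has_real_derivative g t) (at t)" for t
      using F[of t] by (auto intro!: derivative_eq_intros)
    show "F t + c = \<psi> t" if "t \<in> I" for t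
      using c[OF that] by simp
  qed
qed

lemma unbounded_below_if_deriv_bounded:
  fixes f :: "real \<Rightarrow> real"
  assumes "0 < \<delta>" and deriv: "\<And>t. t \<le> c \<Longrightarrow> \<exists>D\<ge>\<delta>. (f has_real_derivative D) (at t)"
  shows "\<not> bdd_below (f ` {..c})"
proof
  assume "bdd_below (f ` {..c})"
  then obtain m where m: "\<And>t. t \<le> c \<Longrightarrow> m \<le> f t"
    by (auto simp: bdd_below_def)
  \<comment> \<open>The time at which the line of slope \<open>\<delta>\<close> through
    \<open>(c, f c)\<close> has the value \<open>m - 1\<close>.\<close>
  define t where "t = c - (f c - m + 1) / \<delta>"
  have "0 \<le> f c - m"
    using m[of c] by simp
  then have t: "t \<le> c"
    using assms(1) by (simp add: t_def)
  have "f t - \<delta> * t \<le> f c - \<delta> * c"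
  proof (rule DERIV_nonneg_imp_nondecreasing[OF t])
    fix x assume "x \<le> c"
    from deriv[OF this] obtain D where "D \<ge> \<delta>" "(f has_real_derivative D) (at x)" by blast
    then show "\<exists>d. ((\<lambda>x. f x - \<delta> * x) has_real_derivative d) (at x) \<and> 0 \<le> d"
      by (intro exI[of _ "D - \<delta>"]) (auto intro!: derivative_eq_intros)
  qed
  moreover have "\<delta> * t = \<delta> * c - (f c - m + 1)"
    using assms(1) by (simp add: t_def right_diff_distrib)
  ultimately show False
    using m[OF t] by simp
qed

subsection \<open>Integrability\<close>

text \<open>Lower slope bound for the power at the singular point \<open>a\<close>. For negative
  \<open>a\<close> and odd \<open>m\<close> the map \<open>y \<mapsto> - y\<close> exchanges the
  roles of the two powers, and the larger absolute value is again that of \<open>a\<close>.\<close>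

lemma power_diff_ge_linear:
  fixes a y :: real
  assumes "a \<le> y" "0 \<le> a \<or> (odd m \<and> y \<le> 0)" "0 < m"
  shows "\<bar>a\<bar> ^ (m - 1) * (y - a) \<le> y ^ m - a ^ m"
proof -
  have pow: "z ^ m = z * z ^ (m - 1)" for z :: real
    using assms(3) by (cases m) auto
  show ?thesis
  proof (cases "0 \<le> a")
    case True
    then have "y * a ^ (m - 1) \<le> y * y ^ (m - 1)"
      using assms(1) by (intro mult_left_mono power_mono) auto
    with True show ?thesis
      by (simp add: pow algebra_simps)
  next
    case False
    then have odd: "odd m" and y: "y \<le> 0"
      using assms(2) by auto
    have "- y * (- y) ^ (m - 1) \<le> - y * (- a) ^ (m - 1)"
      using assms(1) y by (intro mult_left_mono power_mono) auto
    moreover have "even (m - 1)"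
      using odd by simp
    ultimately show ?thesis
      using False by (simp add: pow algebra_simps)
  qed
qed

lemma set_integrable_inverse_sqrt:
  fixes a d :: real
  assumes "a < d"
  shows "set_integrable lborel {a<..<d} (\<lambda>y. 1 / sqrt (y - a))"
proof -
  have "set_integrable lborel (einterval a d) (\<lambda>y. 1 / sqrt (y - a))"
  proof (rule interval_integral_FTC_nonneg(1))
    show "((\<lambda>y. 2 * sqrt (y - a)) has_real_derivative 1 / sqrt (y - a)) (at y)"
      if "ereal a < ereal y" for y
      using that by (auto intro!: derivative_eq_intros simp: field_simps)
    show "isCont (\<lambda>y. 1 / sqrt (y - a)) y" if "ereal a < ereal y" for y
      using that by (auto intro!: continuous_intros)
    have lim: "((\<lambda>y. 2 * sqrt (y - a)) \<longlongrightarrow> 2 * sqrt (z - a)) (at z within S)" for z S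
      by (intro tendsto_intros)
    show "(((\<lambda>y. 2 * sqrt (y - a)) \<circ> real_of_ereal) \<longlongrightarrow> 2 * sqrt (a - a)) (at_right (ereal a))"
      "(((\<lambda>y. 2 * sqrt (y - a)) \<circ> real_of_ereal) \<longlongrightarrow> 2 * sqrt (d - a)) (at_left (ereal d))"
      using lim by (simp_all only: ereal_tendsto_simps)
  qed (use assms in auto)
  then show ?thesis
    by simp
qed

lemma set_integrable_sqrt_singularity:
  fixes f :: "real \<Rightarrow> real"
  assumes f: "f \<in> borel_measurable borel" and c: "0 < c"
    and bound: "\<And>y. a < y \<Longrightarrow> y < d \<Longrightarrow> c * (y - a) \<le> f y"
  shows "set_integrable lborel {a<..<d} (\<lambda>y. 1 / sqrt (f y))"
proof (cases "a < d")
  case True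
  show ?thesis
  proof (rule set_integrable_bound)
    show "set_integrable lborel {a<..<d} (\<lambda>y. 1 / sqrt c * (1 / sqrt (y - a)))"
      by (intro set_integrable_mult_right set_integrable_inverse_sqrt[OF True])
    show "set_borel_measurable lborel {a<..<d} (\<lambda>y. 1 / sqrt (f y))"
      using f by (auto simp: set_borel_measurable_def)
    have "1 / sqrt (f y) \<le> 1 / (sqrt c * sqrt (y - a)) \<and> 0 \<le> f y" if "a < y" "y < d" for y
    proof -
      have "0 < c * (y - a)"
        using c that by simp
      with bound[OF that] show ?thesis
        by (auto simp flip: real_sqrt_mult intro!: divide_left_mono real_sqrt_le_mono mult_pos_pos)
    qed
    then show "AE y in lborel. y \<in> {a<..<d} \<longrightarrow>
        norm (1 / sqrt (f y)) \<le> norm (1 / sqrt c * (1 / sqrt (y - a)))"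
      using c by (intro AE_I2) (auto simp: abs_mult)
  qed
next
  case False
  then have "{a<..<d} = {}" by auto
  then show ?thesis by (simp add: set_integrable_def)
qed

lemma set_integrable_Icc_iff_interval:
  fixes f :: "real \<Rightarrow> real"
  assumes "a \<le> b"
  shows "set_integrable lborel {a..b} f \<longleftrightarrow> interval_lebesgue_integrable lborel (ereal a) (ereal b) f"
proof -
  have "set_integrable lborel {a..b} f \<longleftrightarrow> set_integrable lborel {a<..<b} f"
    by (rule set_integrable_discrete_difference[where X = "{a, b}"]) auto
  with assms show ?thesis
    by (simp add: interval_lebesgue_integrable_def)
qed

subsection \<open>Reflection of solutions\<close>

text \<open>Negating the height as well as the time preserves \<open>\<psi>' \<ge> 0\<close>; the
  second derivative of the radius is unchanged. Statements on decreasing pieces thus reduce to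
  increasing ones.\<close>

lemma curvature_solution_reflect:
  assumes "curvature_solution n K C S \<phi> \<phi>' \<psi> \<psi>'"
  shows "curvature_solution n K C (uminus ` S) (\<lambda>t. \<phi> (- t)) (\<lambda>t. - \<phi>' (- t))
    (\<lambda>t. - \<psi> (- t)) (\<lambda>t. \<psi>' (- t))"
proof -
  have neg: "((\<lambda>t. f (- t)) has_real_derivative - D) (at t within uminus ` T)"
    if "(f has_real_derivative D) (at (- t) within T)" for f :: "real \<Rightarrow> real" and D t T
  proof -
    have "(uminus has_real_derivative - 1) (at t within uminus ` T)"
      by (auto intro!: derivative_eq_intros)
    with DERIV_image_chain[of f D uminus t "uminus ` T" "- 1"] that show ?thesis
      by (simp add: o_def image_image)
  qed
  have neg': "((\<lambda>t. - f (- t)) has_real_derivative D) (at t within uminus ` T)"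
    if "(f has_real_derivative D) (at (- t) within T)" for f :: "real \<Rightarrow> real" and D t T
    using DERIV_minus[OF neg[OF that]] by simp
  have int: "interior (uminus ` S) = uminus ` interior S"
    by (rule interior_negations)
  show ?thesis
    unfolding curvature_solution_def
  proof (intro conjI)
    show "generating_curve (uminus ` S) (\<lambda>t. \<phi> (- t)) (\<lambda>t. - \<phi>' (- t))
        (\<lambda>t. - \<psi> (- t)) (\<lambda>t. \<psi>' (- t))"
      using assms unfolding curvature_solution_def generating_curve_def
      by (auto intro!: neg neg')
    show "first_integral n K C (uminus ` S) (\<lambda>t. \<phi> (- t)) (\<lambda>t. - \<phi>' (- t))"
      using assms unfolding curvature_solution_def first_integral_def by auto
    have "\<exists>D. ((\<lambda>t. - \<phi>' (- t)) has_real_derivative D) (at (- s)) \<and>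
        K * \<phi> s ^ (n - 2) = - D * sqrt (1 - (\<phi>' s)\<^sup>2) ^ (n - 3)" if "s \<in> interior S" for s
    proof -
      from that assms obtain D where "(\<phi>' has_real_derivative D) (at s)"
          "K * \<phi> s ^ (n - 2) = - D * sqrt (1 - (\<phi>' s)\<^sup>2) ^ (n - 3)"
        unfolding curvature_solution_def curvature_ode_def by blast
      with neg'[of \<phi>' D "- s" UNIV] show ?thesis by auto
    qed
    then show "curvature_ode n K (uminus ` S) (\<lambda>t. \<phi> (- t)) (\<lambda>t. - \<phi>' (- t))"
      unfolding curvature_ode_def int by auto
  qed
qed

text \<open>Reversing the orientation changes the sign of the elapsed time but not the bounds of the
  integral, so the sign of the integrand flips.\<close>

lemma inverse_formula_reflect:
  "inverse_formula n K C \<sigma> (uminus ` J) (\<lambda>t. \<phi> (- t)) \<longleftrightarrow> inverse_formula n K C (- \<sigma>) J \<phi>"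
proof -
  have inj: "inj_on (\<lambda>t. \<phi> (- t)) (uminus ` J) \<longleftrightarrow> inj_on \<phi> J"
    by (auto simp: inj_on_def)
  have "t\<^sub>0 - t = (LBINT y=a..b. \<sigma> * quad_integrand n K C y) \<longleftrightarrow>
      t - t\<^sub>0 = (LBINT y=a..b. - \<sigma> * quad_integrand n K C y)" for t t\<^sub>0 a b
    unfolding interval_lebesgue_integral_mult_right by auto
  then show ?thesis
    unfolding inverse_formula_def inj by auto
qed

text \<open>Every height \<open>\<psi> t\<close> is the \<open>k\<close>-th coordinate of a point of
  the hypersurface: take \<open>\<omega>\<close> to be a coordinate vector orthogonal to the axis,
  which exists in dimension at least 2.\<close>

lemma rotation_hypersurface_unbounded:
  fixes k :: "'n::finite"
  assumes card: "2 \<le> CARD('n)" and unbounded: "\<not> bdd_below (\<psi> ` S)"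
  shows "\<not> bounded ((\<lambda>x. x $ k) ` rotation_hypersurface k S \<phi> \<psi>)"
    and "\<not> compact (rotation_hypersurface k S \<phi> \<psi>)"
proof -
  obtain j where j: "j \<noteq> k"
  proof -
    have "UNIV \<noteq> {k}"
      using card by (metis card.empty card_insert_disjoint empty_iff finite.emptyI
          not_less_eq_eq numeral_2_eq_2 le_refl)
    then show ?thesis using that by blast
  qed
  have "\<psi> ` S \<subseteq> (\<lambda>x. x $ k) ` rotation_hypersurface k S \<phi> \<psi>"
  proof (rule image_subsetI)
    fix t assume t: "t \<in> S"
    have "norm (axis j (1::real)) = 1" "axis j (1::real) $ k = 0"
      using j by (simp_all add: norm_axis_1) (simp add: axis_def)
    with t have "\<phi> t *\<^sub>R axis j 1 + \<psi> t *\<^sub>R axis k 1 \<in> rotation_hypersurface k S \<phi> \<psi>"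
      unfolding rotation_hypersurface_def by blast
    moreover have "(\<phi> t *\<^sub>R axis j 1 + \<psi> t *\<^sub>R axis k 1) $ k = \<psi> t"
      using j by (simp add: axis_def)
    ultimately show "\<psi> t \<in> (\<lambda>x. x $ k) ` rotation_hypersurface k S \<phi> \<psi>"
      by (metis imageI)
  qed
  then show unbounded': "\<not> bounded ((\<lambda>x. x $ k) ` rotation_hypersurface k S \<phi> \<psi>)"
    using unbounded bounded_subset bounded_imp_bdd_below by metis
  show "\<not> compact (rotation_hypersurface k S \<phi> \<psi>)"
    using unbounded' bounded_linear_image[OF compact_imp_bounded bounded_linear_vec_nth] by blast
qed

subsection \<open>The profile of a solution\<close>

locale negative_curvature_profile =
  fixes n :: nat and K C :: real
  assumes n: "3 \<le> n" and K: "K < 0" and C: "C < 0"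
begin

definition height_speed :: "real \<Rightarrow> real"
  where "height_speed y = root (n - 1) (K * y ^ (n - 1) - C)"

definition radius_speed :: "real \<Rightarrow> real"
  where "radius_speed y = sqrt (1 - (height_speed y)\<^sup>2)"

text \<open>For \<open>C < -1\<close> the positive radius with \<open>w = 1\<close>, where the curve
  turns; for \<open>C \<ge> -1\<close> the axis.\<close>

definition inner_radius :: real
  where "inner_radius = root (n - 1) (max 0 ((C + 1) / K))"

definition outer_radius :: real
  where "outer_radius = root (n - 1) (C / K)"

text \<open>For \<open>C = -1\<close> the radius 0 is left out because the time integral diverges
  there.\<close>

definition radii :: "real set"
  where "radii = {y. inner_radius \<le> y \<and> y \<le> outer_radius \<and> (C = -1 \<longrightarrow> 0 < y)}"

lemma n_pos [simp]: "Suc 0 < n" "0 < n - 1"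
  using n by auto

lemma inner_radius_nonneg: "0 \<le> inner_radius"
  by (simp add: inner_radius_def)

lemma outer_radius_pos: "0 < outer_radius"
  using K C by (simp add: outer_radius_def divide_neg_neg)

lemma outer_radius_power: "outer_radius ^ (n - 1) = C / K"
  unfolding outer_radius_def using K C by (intro real_root_pow_pos2) (auto simp: divide_nonpos_neg)

lemma inner_radius_power: "inner_radius ^ (n - 1) = max 0 ((C + 1) / K)"
  unfolding inner_radius_def by (intro real_root_pow_pos2) auto

lemma inner_less_outer: "inner_radius < outer_radius"
  unfolding inner_radius_def outer_radius_def using K C
  by (auto simp: divide_neg_neg divide_less_cancel)

lemma inner_radius_eq_0: "-1 \<le> C \<Longrightarrow> inner_radius = 0"
  using K by (auto simp: inner_radius_def max_def divide_le_0_iff zero_le_divide_iff)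

lemma inner_radius_pos: "C < -1 \<Longrightarrow> 0 < inner_radius"
  using K by (auto simp: inner_radius_def less_max_iff_disj divide_neg_neg)

lemma inner_radius_power': "C < -1 \<Longrightarrow> K * inner_radius ^ (n - 1) - C = 1"
  unfolding inner_radius_power using K by (simp add: max_def divide_le_0_iff zero_le_divide_iff)

lemma le_outer_radius_iff:
  assumes "0 \<le> y"
  shows "y \<le> outer_radius \<longleftrightarrow> 0 \<le> K * y ^ (n - 1) - C"
    and "y < outer_radius \<longleftrightarrow> 0 < K * y ^ (n - 1) - C"
proof -
  have *: "y \<le> outer_radius \<longleftrightarrow> y ^ (n - 1) \<le> outer_radius ^ (n - 1)"
    using power_mono_iff[of y outer_radius "n - 1"] assms outer_radius_pos by simp
  show "y \<le> outer_radius \<longleftrightarrow> 0 \<le> K * y ^ (n - 1) - C"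
    unfolding * outer_radius_power using K by (simp add: field_simps)
  have "outer_radius \<le> y \<longleftrightarrow> outer_radius ^ (n - 1) \<le> y ^ (n - 1)"
    using power_mono_iff[of outer_radius y "n - 1"] assms outer_radius_pos by auto
  then have *: "y < outer_radius \<longleftrightarrow> y ^ (n - 1) < outer_radius ^ (n - 1)"
    by linarith
  show "y < outer_radius \<longleftrightarrow> 0 < K * y ^ (n - 1) - C"
    unfolding * outer_radius_power using K by (simp add: field_simps)
qed

lemma inner_radius_le_iff:
  assumes "0 \<le> y"
  shows "inner_radius \<le> y \<longleftrightarrow> K * y ^ (n - 1) - C \<le> 1"
proof -
  have "inner_radius \<le> y \<longleftrightarrow> inner_radius ^ (n - 1) \<le> y ^ (n - 1)"
    using power_mono_iff[of inner_radius y "n - 1"] assms inner_radius_nonneg by simp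
  also have "\<dots> \<longleftrightarrow> (C + 1) / K \<le> y ^ (n - 1)"
    unfolding inner_radius_power using assms by simp
  also have "\<dots> \<longleftrightarrow> K * y ^ (n - 1) - C \<le> 1"
    using K by (simp add: field_simps)
  finally show ?thesis .
qed

text \<open>The form in which the first integral gives membership: along a curve,
  \<open>K * y ^ (n - 1) - C\<close> is a power of \<open>\<psi>'\<close>, which lies between 0 and
  1.\<close>

lemma radii_iff:
  "y \<in> radii \<longleftrightarrow> 0 \<le> y \<and> 0 \<le> K * y ^ (n - 1) - C \<and> K * y ^ (n - 1) - C \<le> 1 \<and> (C = -1 \<longrightarrow> y \<noteq> 0)"
  using le_outer_radius_iff(1)[of y] inner_radius_le_iff[of y] inner_radius_nonneg
  unfolding radii_def by (cases "0 \<le> y") auto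

lemma radiiD: "y \<in> radii \<Longrightarrow> inner_radius \<le> y" "y \<in> radii \<Longrightarrow> y \<le> outer_radius" "y \<in> radii \<Longrightarrow> 0 \<le> y"
  using inner_radius_nonneg by (auto simp: radii_def)

lemma outer_radius_in_radii: "outer_radius \<in> radii"
  using inner_less_outer outer_radius_pos by (auto simp: radii_def)

lemma radii_eq:
  "C \<noteq> -1 \<Longrightarrow> radii = {inner_radius..outer_radius}" "C = -1 \<Longrightarrow> radii = {0<..outer_radius}"
proof -
  show "C \<noteq> -1 \<Longrightarrow> radii = {inner_radius..outer_radius}"
    by (auto simp: radii_def)
  assume C: "C = -1"
  have "inner_radius = 0"
    using C by (intro inner_radius_eq_0) simp
  with C show "radii = {0<..outer_radius}"
    unfolding radii_def by (simp add: set_eq_iff) (metis less_imp_le)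
qed

lemma is_interval_radii: "is_interval radii"
  using radii_eq by (metis is_interval_cc is_interval_oc)

lemma ivl_outer_subset_radii: "y \<in> radii \<Longrightarrow> {y..outer_radius} \<subseteq> radii"
  by (auto simp: radii_def)

lemma open_ivl_subset_radii: "{inner_radius<..outer_radius} \<subseteq> radii"
  using inner_radius_nonneg by (auto simp: radii_def)

section \<open>Height speed and radius speed on the admissible radii\<close>

lemma height_speed_power:
  assumes "0 \<le> K * y ^ (n - 1) - C"
  shows "height_speed y ^ (n - 1) = K * y ^ (n - 1) - C"
  unfolding height_speed_def using assms by (intro real_root_pow_pos2) auto

lemma height_speed_nonneg: "y \<in> radii \<Longrightarrow> 0 \<le> height_speed y"
  by (simp add: radii_iff height_speed_def)

lemma height_speed_le_1: "y \<in> radii \<Longrightarrow> height_speed y \<le> 1"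
  by (simp add: radii_iff height_speed_def)

lemma height_speed_pos: "y \<in> radii \<Longrightarrow> y < outer_radius \<Longrightarrow> 0 < height_speed y"
  using le_outer_radius_iff(2)[of y] by (simp add: radii_iff height_speed_def)

text \<open>Two ways to stay away from \<open>w = 1\<close>: a radius beyond the inner one, or
  \<open>-1 < C\<close>, where even on the axis \<open>w ^ (n - 1) = - C < 1\<close>.\<close>

lemma height_speed_less_1:
  assumes "y \<in> radii" "inner_radius < y \<or> -1 < C"
  shows "height_speed y < 1"
proof -
  have y: "0 \<le> y" using assms by (simp add: radii_iff)
  have "K * y ^ (n - 1) - C < 1"
  proof (cases "inner_radius < y")
    case True
    then have "inner_radius ^ (n - 1) < y ^ (n - 1)"
      using inner_radius_nonneg by (intro power_strict_mono) auto
    then have "(C + 1) / K < y ^ (n - 1)"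
      unfolding inner_radius_power by simp
    with K show ?thesis by (simp add: field_simps)
  next
    case False
    with assms have "-1 < C" by simp
    moreover have "K * y ^ (n - 1) \<le> 0"
      using K y by (intro mult_nonpos_nonneg) auto
    ultimately show ?thesis by simp
  qed
  then show ?thesis by (simp add: height_speed_def)
qed

lemma continuous_on_height_speed [continuous_intros]:
  "continuous_on S f \<Longrightarrow> continuous_on S (\<lambda>x. height_speed (f x))"
  unfolding height_speed_def by (intro continuous_intros)

lemma continuous_on_radius_speed [continuous_intros]:
  "continuous_on S f \<Longrightarrow> continuous_on S (\<lambda>x. radius_speed (f x))"
  unfolding radius_speed_def by (intro continuous_intros)

lemma speeds_square:
  assumes "y \<in> radii"
  shows "(radius_speed y)\<^sup>2 + (height_speed y)\<^sup>2 = 1"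
proof -
  have "(height_speed y)\<^sup>2 \<le> 1"
    using height_speed_nonneg[OF assms] height_speed_le_1[OF assms] by (simp add: power_le_one)
  then show ?thesis by (simp add: radius_speed_def)
qed

lemma radius_speed_pos: "y \<in> radii \<Longrightarrow> inner_radius < y \<or> -1 < C \<Longrightarrow> 0 < radius_speed y"
  using height_speed_nonneg[of y] height_speed_less_1[of y]
  by (simp add: radius_speed_def abs_square_less_1)

lemma sqrt_radius_speed:
  assumes "y \<in> radii"
  shows "sqrt (1 - (radius_speed y)\<^sup>2) = height_speed y"
proof -
  have "1 - (radius_speed y)\<^sup>2 = (height_speed y)\<^sup>2"
    using speeds_square[OF assms] by simp
  then show ?thesis using height_speed_nonneg[OF assms] by simp
qed

lemma radius_speed_inner: "C < -1 \<Longrightarrow> radius_speed inner_radius = 0"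
  using inner_radius_power' by (simp add: radius_speed_def height_speed_def)

lemma quad_integrand_eq: "quad_integrand n K C y = 1 / radius_speed y"
  by (simp add: quad_integrand_def radius_speed_def height_speed_def)

section \<open>Integrability of the quadrature integrand\<close>

lemma continuous_on_quad_integrand:
  "(\<And>y. y \<in> S \<Longrightarrow> radius_speed y \<noteq> 0) \<Longrightarrow> continuous_on S (quad_integrand n K C)"
  unfolding quad_integrand_eq by (intro continuous_intros) auto

text \<open>With \<open>w\<close> the height speed, \<open>1 - w\<^sup>2 \<ge> 1 - w \<ge> (1 - w ^ (n - 1)) / (n - 1)\<close> by Bernoulli's
  inequality, so the integrand has at most an inverse square root singularity at the root of
  \<open>K y ^ (n - 1) - C = 1\<close>.\<close>

lemma radius_speed_lower_bound:
  assumes "0 \<le> K * y ^ (n - 1) - C" "K * y ^ (n - 1) - C \<le> 1"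
  shows "(1 - (K * y ^ (n - 1) - C)) / (n - 1) \<le> 1 - (height_speed y)\<^sup>2"
proof -
  define w where "w = height_speed y"
  have w: "0 \<le> w" "w \<le> 1" "w ^ (n - 1) = K * y ^ (n - 1) - C"
    using assms height_speed_power by (auto simp: w_def height_speed_def)
  have "(1 - w ^ m) / m \<le> 1 - w" if "0 < m" for m
    using Bernoulli_inequality[of "w - 1" m] w that by (simp add: field_simps)
  from this[OF n_pos(2)] have "(1 - w ^ (n - 1)) / (n - 1) \<le> 1 - w" .
  also have "\<dots> \<le> 1 - w\<^sup>2"
    using w by (simp add: power2_eq_square mult_left_le)
  finally show ?thesis
    by (simp only: w(3) w_def[symmetric])
qed

text \<open>Covers both kinds of singular point: the inner radius for \<open>C < -1\<close>, and the
  negative \<open>a\<close> with \<open>w = 1\<close> that occurs for \<open>C > -1\<close> and odd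
  \<open>n - 1\<close>.\<close>

lemma set_integrable_quad_integrand_singular:
  assumes a: "K * a ^ (n - 1) - C = 1" "a \<noteq> 0"
    and y: "\<And>y. a < y \<Longrightarrow> y < d \<Longrightarrow> 0 \<le> a \<or> (odd (n - 1) \<and> y \<le> 0)"
    and range: "\<And>y. a < y \<Longrightarrow> y < d \<Longrightarrow> 0 \<le> K * y ^ (n - 1) - C"
  shows "set_integrable lborel {a<..<d} (quad_integrand n K C)"
proof -
  \<comment> \<open>The slope bound \<open>- K * \<bar>a\<bar> ^ (n - 2)\<close> for the decrease of
    \<open>w ^ (n - 1)\<close>, divided by the \<open>n - 1\<close> from Bernoulli's inequality. It
    is positive because \<open>a \<noteq> 0\<close>.\<close>
  define c where "c = - K * \<bar>a\<bar> ^ (n - 1 - 1) / (n - 1)"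
  have "set_integrable lborel {a<..<d} (\<lambda>y. 1 / sqrt (1 - (height_speed y)\<^sup>2))"
  proof (rule set_integrable_sqrt_singularity)
    show "(\<lambda>y. 1 - (height_speed y)\<^sup>2) \<in> borel_measurable borel"
      by (intro borel_measurable_continuous_onI continuous_intros)
    show "0 < c"
      unfolding c_def using K a n_pos(2) by (intro divide_pos_pos mult_pos_pos) auto
    fix z assume z: "a < z" "z < d"
    have "\<bar>a\<bar> ^ (n - 1 - 1) * (z - a) \<le> z ^ (n - 1) - a ^ (n - 1)"
      using z y[OF z] by (intro power_diff_ge_linear) auto
    then have "- K * (\<bar>a\<bar> ^ (n - 1 - 1) * (z - a)) \<le> - K * (z ^ (n - 1) - a ^ (n - 1))"
      using K by (intro mult_left_mono) auto
    also have "\<dots> = 1 - (K * z ^ (n - 1) - C)"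
      using a(1) by (simp add: algebra_simps)
    finally have *: "- K * (\<bar>a\<bar> ^ (n - 1 - 1) * (z - a)) \<le> 1 - (K * z ^ (n - 1) - C)" .
    have "0 \<le> - K * (\<bar>a\<bar> ^ (n - 1 - 1) * (z - a))"
      using K z by (intro mult_nonneg_nonneg) auto
    with * have "K * z ^ (n - 1) - C \<le> 1" by linarith
    from radius_speed_lower_bound[OF range[OF z] this]
    have "(1 - (K * z ^ (n - 1) - C)) / (n - 1) \<le> 1 - (height_speed z)\<^sup>2" .
    moreover have "c * (z - a) \<le> (1 - (K * z ^ (n - 1) - C)) / (n - 1)"
      using divide_right_mono[OF *, of "real (n - 1)"] by (simp add: c_def mult.assoc)
    ultimately show "c * (z - a) \<le> 1 - (height_speed z)\<^sup>2" by (rule order_trans[rotated])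
  qed
  then show ?thesis
    by (simp add: quad_integrand_eq[abs_def] radius_speed_def)
qed

lemma height_speed_antimono: "0 \<le> x \<Longrightarrow> x \<le> y \<Longrightarrow> height_speed y \<le> height_speed x"
  unfolding height_speed_def using K
  by (subst real_root_le_iff) (auto intro!: mult_left_mono_neg power_mono)

lemma radius_speed_nz: "y \<in> radii \<Longrightarrow> inner_radius < y \<or> -1 \<le> C \<Longrightarrow> radius_speed y \<noteq> 0"
  using radius_speed_pos[of y] inner_radius_eq_0 by (auto simp: radii_def)

text \<open>A singularity can lie in \<open>{y..outer_radius}\<close> only if \<open>C < -1\<close>.
  Otherwise \<open>w < 1\<close> on all of \<open>radii\<close>, and the integrand is continuous up
  to both ends.\<close>

lemma set_integrable_quad_integrand:
  assumes "y \<in> radii"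
  shows "set_integrable lborel {y..outer_radius} (quad_integrand n K C)"
proof (cases "C < -1")
  case True
  have "set_integrable lborel {inner_radius<..<outer_radius} (quad_integrand n K C)"
  proof (rule set_integrable_quad_integrand_singular)
    show "0 \<le> K * z ^ (n - 1) - C" if "inner_radius < z" "z < outer_radius" for z
      using le_outer_radius_iff(1)[of z] that inner_radius_nonneg by simp
  qed (use True inner_radius_power' inner_radius_pos in auto)
  then have "set_integrable lborel {inner_radius..outer_radius} (quad_integrand n K C)"
    using inner_less_outer by (simp add: set_integrable_Icc_iff_interval interval_lebesgue_integrable_def)
  then show ?thesis
    by (rule set_integrable_subset) (use radiiD[OF assms] in auto)
next
  case False
  then have "continuous_on {y..outer_radius} (quad_integrand n K C)"
    using ivl_outer_subset_radii[OF assms] radius_speed_nz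
    by (intro continuous_on_quad_integrand) (auto simp: subset_iff)
  then show ?thesis
    by (rule borel_integrable_atLeastAtMost')
qed

text \<open>Controls the part of the integral for \<open>D' - C'\<close> that lies below the axis.
  The lower bound 1 holds because \<open>sqrt (1 - w\<^sup>2)\<close> is positive and at most 1
  there.\<close>

lemma set_integrable_quad_integrand_negative:
  assumes C': "-1 < C" and a: "a = root (n - 1) ((C + 1) / K)"
  shows "set_integrable lborel {a..0} (quad_integrand n K C)"
    and "a < y \<Longrightarrow> y \<le> 0 \<Longrightarrow> 1 \<le> quad_integrand n K C y"
proof -
  have a_neg: "a < 0"
    using C' K by (simp add: a divide_pos_neg)
  have speed_pos: "0 < radius_speed z" if "\<bar>K * z ^ (n - 1) - C\<bar> < 1" for z
  proof -
    have "\<bar>height_speed z\<bar> < 1"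
      using that unfolding height_speed_def real_root_abs[OF n_pos(2), symmetric] by simp
    then show ?thesis
      by (simp add: radius_speed_def abs_square_less_1)
  qed
  have *: "set_integrable lborel {a..0} (quad_integrand n K C) \<and>
      (\<forall>z. a < z \<and> z \<le> 0 \<longrightarrow> 0 < radius_speed z)"
  proof (cases "even (n - 1)")
    \<comment> \<open>With the odd extension of \<open>root\<close>, here
      \<open>a ^ (n - 1) = - ((C + 1) / K)\<close>, so \<open>w ^ (n - 1) = 1\<close> fails at
      \<open>a\<close>. Instead \<open>K * z ^ (n - 1) - C\<close> stays between
      \<open>- 1 - 2 * C\<close> and \<open>- C\<close>, both in the open interval from -1 to 1, and
      there is no singularity.\<close>
    case True
    have "a ^ (n - 1) = (- a) ^ (n - 1)"
      using True by (simp only: power_minus_even)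
    also have "\<dots> = - ((C + 1) / K)"
      unfolding a real_root_minus[symmetric] using C' K
      by (intro real_root_pow_pos2) (auto simp: divide_nonneg_neg)
    finally have a_pow: "a ^ (n - 1) = - ((C + 1) / K)" .
    have "0 < radius_speed z" if z: "z \<in> {a..0}" for z
    proof (rule speed_pos)
      have "(- z) ^ (n - 1) \<le> (- a) ^ (n - 1)"
        using z by (intro power_mono) auto
      then have "z ^ (n - 1) \<le> - ((C + 1) / K)"
        using True a_pow by (simp only: power_minus_even)
      then have "K * (- ((C + 1) / K)) \<le> K * z ^ (n - 1)"
        using K by (intro mult_left_mono_neg) auto
      then have "- 1 - C \<le> K * z ^ (n - 1)"
        using K by simp
      moreover have "K * z ^ (n - 1) \<le> 0"
        using K True by (intro mult_nonpos_nonneg) (auto simp: zero_le_even_power)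
      ultimately show "\<bar>K * z ^ (n - 1) - C\<bar> < 1"
        using C C' by (simp only: abs_if split: if_split) linarith
    qed
    then show ?thesis
      by (force intro!: borel_integrable_atLeastAtMost' continuous_on_quad_integrand)
  next
    \<comment> \<open>Now \<open>a\<close> really satisfies \<open>w = 1\<close>, and the
      singularity is of inverse square root type.\<close>
    case False
    then have a_pow: "a ^ (n - 1) = (C + 1) / K"
      unfolding a by (intro odd_real_root_pow)
    have range: "0 \<le> K * z ^ (n - 1) - C" if "z \<le> 0" for z
    proof -
      have "z ^ (n - 1) \<le> 0"
        using False that by (simp add: power_le_zero_eq)
      then have "0 \<le> K * z ^ (n - 1)"
        using K by (intro mult_nonpos_nonpos) auto
      with C show ?thesis by linarith
    qed
    have "set_integrable lborel {a<..<0} (quad_integrand n K C)"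
      by (intro set_integrable_quad_integrand_singular)
        (use K a_neg False range a_pow in auto)
    then have "set_integrable lborel {a..0} (quad_integrand n K C)"
      using a_neg by (simp add: set_integrable_Icc_iff_interval interval_lebesgue_integrable_def)
    moreover have "0 < radius_speed z" if z: "a < z" "z \<le> 0" for z
    proof (rule speed_pos)
      have "(- z) ^ (n - 1) < (- a) ^ (n - 1)"
        using z by (intro power_strict_mono) auto
      then have "a ^ (n - 1) < z ^ (n - 1)"
        by (simp only: power_minus_odd[OF False] neg_less_iff_less)
      then have "K * z ^ (n - 1) < K * ((C + 1) / K)"
        unfolding a_pow[symmetric] using K by simp
      then have "K * z ^ (n - 1) - C < 1"
        using K by simp
      with range[OF z(2)] show "\<bar>K * z ^ (n - 1) - C\<bar> < 1"
        by (simp only: abs_of_nonneg)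
    qed
    ultimately show ?thesis by blast
  qed
  then show "set_integrable lborel {a..0} (quad_integrand n K C)" ..
  show "1 \<le> quad_integrand n K C y" if "a < y" "y \<le> 0"
    using * that by (auto simp: quad_integrand_eq radius_speed_def)
qed

lemma quad_integrable_between_radii:
  assumes "x \<in> radii" "y \<in> radii"
  shows "quad_integrable_between n K C x y"
  using assms
proof (induction x y rule: linorder_wlog)
  case (le x y)
  have "set_integrable lborel {x..y} (quad_integrand n K C)"
    by (rule set_integrable_subset[OF set_integrable_quad_integrand[of x]])
      (use le radiiD[of y] in auto)
  then show ?case
    using le(1) by (simp add: quad_integrable_between_def set_integrable_Icc_iff_interval)
next
  case (sym x y)
  then show ?case
    by (simp add: quad_integrable_between_def interval_integrable_endpoints_reverse)
qed

lemma quad_integrable_between_outer: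
  assumes "C \<noteq> -1" and a: "a = root (n - 1) ((C + 1) / K)"
  shows "quad_integrable_between n K C a outer_radius"
proof (cases "C < -1")
  case True
  then have "a = inner_radius"
    using K by (simp add: a inner_radius_def max_def divide_le_0_iff zero_le_divide_iff)
  moreover have "inner_radius \<in> radii"
    using True inner_less_outer by (simp add: radii_def)
  ultimately show ?thesis
    using quad_integrable_between_radii outer_radius_in_radii by simp
next
  case False
  with assms have C': "-1 < C" by simp
  have "a < 0"
    using C' K by (simp add: a divide_pos_neg)
  have "0 \<in> radii"
    using C' inner_radius_eq_0 outer_radius_pos by (simp add: radii_def)
  then have "set_integrable lborel ({a..0} \<union> {0..outer_radius}) (quad_integrand n K C)"
    using set_integrable_quad_integrand_negative(1)[OF C' a]
    by (intro set_integrable_Un set_integrable_quad_integrand) auto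
  also have "{a..0} \<union> {0..outer_radius} = {a..outer_radius}"
    using \<open>a < 0\<close> outer_radius_pos by auto
  finally show ?thesis
    using \<open>a < 0\<close> outer_radius_pos
    by (simp add: quad_integrable_between_def set_integrable_Icc_iff_interval)
qed

text \<open>Compares half of \<open>D' - C'\<close> with \<open>T\<close>: equality makes the two
  branches meet at the turning point, strict inequality leaves a gap between them.\<close>

lemma quad_time_full:
  assumes a: "a = root (n - 1) ((C + 1) / K)"
  shows "C < -1 \<Longrightarrow> quad_time n K C a outer_radius = quad_time n K C inner_radius outer_radius"
    and "-1 < C \<Longrightarrow> quad_time n K C inner_radius outer_radius < quad_time n K C a outer_radius"
proof -
  show "quad_time n K C a outer_radius = quad_time n K C inner_radius outer_radius" if "C < -1"
  proof -
    have "a = inner_radius"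
      using K that by (simp add: a inner_radius_def max_def divide_le_0_iff zero_le_divide_iff)
    then show ?thesis by simp
  qed
  assume C': "-1 < C"
  have a_neg: "a < 0"
    using C' K by (simp add: a divide_pos_neg)
  let ?q = "quad_integrand n K C"
  have int: "set_integrable lborel {a..0} ?q"
    by (rule set_integrable_quad_integrand_negative(1)[OF C' a])
  have int': "interval_lebesgue_integrable lborel (ereal a) (ereal outer_radius) ?q"
    using quad_integrable_between_outer[OF _ a] C' by (simp add: quad_integrable_between_def)
  have "quad_time n K C a 0 + quad_time n K C 0 outer_radius = quad_time n K C a outer_radius"
    unfolding quad_time_def using int' a_neg outer_radius_pos
    by (intro interval_integral_sum) (simp add: min_def max_def)
  moreover have "0 < quad_time n K C a 0"
  proof -
    text \<open>At \<open>a\<close> the integrand may take the junk value \<open>1 / 0 = 0\<close>; elsewhere it is at least \<open>1\<close>.\<close>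
    define q' where "q' y = max 1 (?q y)" for y
    have q': "?q y = q' y" if "y \<in> {a..0} - {a}" for y
      using set_integrable_quad_integrand_negative(2)[OF C' a, of y] that by (auto simp: q'_def)
    have q_int: "?q integrable_on {a..0}"
      by (rule set_borel_integral_eq_integral(1)[OF int])
    have q'_int: "q' integrable_on {a..0}"
      by (rule integrable_spike_finite[OF _ _ q_int, of "{a}"]) (use q' in auto)
    have "- a = integral {a..0} (\<lambda>y. 1)"
      using a_neg by simp
    also have "\<dots> \<le> integral {a..0} q'"
      using q'_int by (intro integral_le) (auto simp: q'_def)
    also have "\<dots> = integral {a..0} ?q"
      by (rule integral_spike[of "{a}"]) (use q' in auto)
    also have "\<dots> = quad_time n K C a 0"
      using a_neg set_borel_integral_eq_integral(2)[OF int]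
      unfolding quad_time_def by (subst interval_integral_Icc) auto
    finally show ?thesis
      using a_neg by simp
  qed
  ultimately show "quad_time n K C inner_radius outer_radius < quad_time n K C a outer_radius"
    using C' inner_radius_eq_0 by simp
qed

subsection \<open>Elapsed time and its inverse\<close>

text \<open>The antiderivative \<open>F\<close>, normalised at the outer radius: there
  \<open>w = 0\<close>, so this base point is regular for every \<open>C\<close>, whereas the inner
  end may be singular or at infinite distance. All times are therefore at most 0.\<close>

definition radius_time :: "real \<Rightarrow> real"
  where "radius_time y = - quad_time n K C y outer_radius"

definition times :: "real set"
  where "times = radius_time ` radii"

definition time_radius :: "real \<Rightarrow> real"
  where "time_radius = inv_into radii radius_time"

lemma radius_time_eq_integral:
  assumes "y \<in> radii"
  shows "radius_time y = - integral {y..outer_radius} (quad_integrand n K C)"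
  using set_borel_integral_eq_integral(2)[OF set_integrable_quad_integrand[OF assms]] radiiD(2)[OF assms]
  by (simp add: radius_time_def quad_time_def interval_integral_Icc)

lemma quad_integrand_integrable_on: "y \<in> radii \<Longrightarrow> quad_integrand n K C integrable_on {y..outer_radius}"
  using set_borel_integral_eq_integral(1)[OF set_integrable_quad_integrand] .

lemma quad_time_radii:
  assumes "x \<in> radii" "y \<in> radii"
  shows "quad_time n K C x y = radius_time y - radius_time x"
proof -
  have "min x y \<in> radii"
    using assms by (simp add: min_def)
  then have "interval_lebesgue_integrable lborel (ereal (min x y)) (ereal outer_radius) (quad_integrand n K C)"
    using quad_integrable_between_radii[OF _ outer_radius_in_radii]
    unfolding quad_integrable_between_def by blast
  moreover have "min (ereal x) (min (ereal y) (ereal outer_radius)) = ereal (min x y)"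
      "max (ereal x) (max (ereal y) (ereal outer_radius)) = ereal outer_radius"
    using radiiD[OF assms(1)] radiiD[OF assms(2)] by (simp_all add: min_def max_def)
  ultimately have "quad_time n K C x y + quad_time n K C y outer_radius = quad_time n K C x outer_radius"
    unfolding quad_time_def by (intro interval_integral_sum) simp
  then show ?thesis
    by (simp add: radius_time_def)
qed

lemma has_real_derivative_radius_time:
  assumes "y \<in> {inner_radius<..<outer_radius}"
  shows "(radius_time has_real_derivative 1 / radius_speed y) (at y)"
proof -
  \<comment> \<open>A base point strictly beyond the inner radius keeps the singularity out, so the
    integrand is continuous on \<open>{c..outer_radius}\<close>.\<close>
  define c where "c = (inner_radius + y) / 2"
  have c: "inner_radius < c" "c < y" "c < outer_radius"
    using assms by (auto simp: c_def)
  then have c_radii: "c \<in> radii"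
    using open_ivl_subset_radii by auto
  have "continuous_on {c..outer_radius} (quad_integrand n K C)"
    using ivl_outer_subset_radii[OF c_radii] c
    by (intro continuous_on_quad_integrand radius_speed_nz) auto
  then have "((\<lambda>z. integral {c..z} (quad_integrand n K C)) has_real_derivative quad_integrand n K C y)
      (at y within {c..outer_radius})"
    using c assms by (intro integral_has_real_derivative) auto
  then have "((\<lambda>z. integral {c..z} (quad_integrand n K C) - integral {c..outer_radius} (quad_integrand n K C))
      has_real_derivative quad_integrand n K C y) (at y within {c..outer_radius})"
    by (auto intro!: derivative_eq_intros)
  then have "(radius_time has_real_derivative quad_integrand n K C y) (at y within {c..outer_radius})"
  proof (rule has_field_derivative_transform_within[where d = 1])
    fix z assume z: "z \<in> {c..outer_radius}"
    then have "z \<in> radii"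
      using ivl_outer_subset_radii[OF c_radii] by auto
    with z Henstock_Kurzweil_Integration.integral_combine[OF _ _ quad_integrand_integrable_on[OF c_radii], of z]
    show "integral {c..z} (quad_integrand n K C) - integral {c..outer_radius} (quad_integrand n K C) = radius_time z"
      by (simp add: radius_time_eq_integral)
  qed (use c assms in auto)
  moreover have "y \<in> interior {c..outer_radius}"
    using c assms by auto
  ultimately show ?thesis
    by (simp add: at_within_interior[of y "{c..outer_radius}"] quad_integrand_eq)
qed

lemma continuous_on_radius_time: "continuous_on radii radius_time"
  unfolding continuous_on_eq_continuous_within
proof
  fix y assume y: "y \<in> radii"
  \<comment> \<open>The closed interval from the inner radius is all of \<open>radii\<close> unless
    \<open>C = -1\<close>. In that case it would contain 0, and \<open>y / 2\<close> leaves room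
    below \<open>y\<close> instead.\<close>
  define c where "c = (if C = -1 then y / 2 else inner_radius)"
  have c: "c \<in> radii" "c \<le> y" "{c..outer_radius} = radii \<or> c < y"
    using y inner_less_outer inner_radius_eq_0 by (auto simp: c_def radii_def)
  have "continuous_on {c..outer_radius} (\<lambda>z. - integral {z..outer_radius} (quad_integrand n K C))"
    by (intro continuous_intros indefinite_integral_continuous_1' quad_integrand_integrable_on c)
  then have "continuous_on {c..outer_radius} radius_time"
    by (rule continuous_on_eq)
      (use ivl_outer_subset_radii[OF c(1)] in \<open>auto intro!: radius_time_eq_integral[symmetric]\<close>)
  then have "continuous (at y within {c..outer_radius}) radius_time"
    using y c radiiD by (simp add: continuous_on_eq_continuous_within)
  moreover have "at y within radii = at y within {c..outer_radius}" if "c < y"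
  proof (rule at_within_nhd)
    show "y \<in> {c<..}" "open {c<..}" "radii \<inter> {c<..} - {y} = {c..outer_radius} \<inter> {c<..} - {y}"
      using that ivl_outer_subset_radii[OF c(1)] radiiD(2) by auto
  qed
  ultimately show "continuous (at y within radii) radius_time"
    using c by auto
qed

lemma radius_time_strict_mono: "strict_mono_on radii radius_time"
proof (rule strict_mono_onI)
  fix x y assume xy: "x \<in> radii" "y \<in> radii" "x < y"
  show "radius_time x < radius_time y"
  proof (rule DERIV_pos_imp_increasing_open[OF xy(3)])
    fix z assume z: "x < z" "z < y"
    then have z': "z \<in> {inner_radius<..<outer_radius}"
      using radiiD[OF xy(1)] radiiD[OF xy(2)] by auto
    then have "0 < radius_speed z"
      using open_ivl_subset_radii by (intro radius_speed_pos) auto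
    with has_real_derivative_radius_time[OF z']
    show "\<exists>d. (radius_time has_real_derivative d) (at z) \<and> 0 < d"
      by (intro exI[of _ "1 / radius_speed z"]) simp
  qed (use is_interval_ivl_subset[OF is_interval_radii] xy in
      \<open>auto intro: continuous_on_subset[OF continuous_on_radius_time]\<close>)
qed

lemma inj_on_radius_time: "inj_on radius_time radii"
  using radius_time_strict_mono by (rule strict_mono_on_imp_inj_on)

lemma radius_time_outer: "radius_time outer_radius = 0"
  by (simp add: radius_time_def quad_time_def)

lemma times_nonpos: "s \<in> times \<Longrightarrow> s \<le> 0"
  unfolding times_def
  using strict_mono_on_leD[OF radius_time_strict_mono _ outer_radius_in_radii] radiiD(2)
  by (auto simp: radius_time_outer)

lemma is_interval_times: "is_interval times"
  unfolding times_def is_interval_connected_1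
  using is_interval_radii is_interval_connected_1
  by (intro connected_continuous_image continuous_on_radius_time) auto

lemma zero_in_times: "0 \<in> times"
  unfolding times_def using outer_radius_in_radii radius_time_outer by (metis imageI)

lemma time_radius_radius_time [simp]: "y \<in> radii \<Longrightarrow> time_radius (radius_time y) = y"
  unfolding time_radius_def by (rule inv_into_f_f[OF inj_on_radius_time])

lemma radius_time_time_radius [simp]: "s \<in> times \<Longrightarrow> radius_time (time_radius s) = s"
  unfolding time_radius_def times_def by (rule f_inv_into_f)

lemma time_radius_in_radii: "s \<in> times \<Longrightarrow> time_radius s \<in> radii"
  unfolding time_radius_def times_def by (rule inv_into_into)

lemma times_eq_atLeastAtMost:
  assumes "C \<noteq> -1"
  shows "times = {- quad_time n K C inner_radius outer_radius..0}"
proof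
  have inner: "inner_radius \<in> radii"
    using assms inner_less_outer by (simp add: radii_def)
  have "- quad_time n K C inner_radius outer_radius \<in> times"
    using inner by (auto simp: times_def simp flip: radius_time_def)
  then show "{- quad_time n K C inner_radius outer_radius..0} \<subseteq> times"
    using zero_in_times by (intro is_interval_ivl_subset is_interval_times)
  show "times \<subseteq> {- quad_time n K C inner_radius outer_radius..0}"
    using times_nonpos strict_mono_on_leD[OF radius_time_strict_mono inner] radiiD(1)
    by (auto simp: times_def simp flip: radius_time_def)
qed

lemma quad_time_inner_nonneg: "C \<noteq> -1 \<Longrightarrow> 0 \<le> quad_time n K C inner_radius outer_radius"
  using times_eq_atLeastAtMost zero_in_times by auto

text \<open>From \<open>n - 1 \<ge> 2\<close> and \<open>w \<le> 1\<close> comes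
  \<open>1 - w\<^sup>2 \<le> 1 - w ^ (n - 1) = - K * y ^ (n - 1)\<close>. All but two of the factors
  \<open>y\<close> are then bounded by the outer radius.\<close>

lemma radius_speed_linear_bound:
  assumes C: "C = -1"
  obtains L where "0 < L" "\<And>y. y \<in> radii \<Longrightarrow> radius_speed y \<le> L * y"
proof
  let ?M = "- K * outer_radius ^ (n - 3)"
  show "0 < sqrt ?M"
    using K outer_radius_pos by (simp add: mult_neg_pos)
  show "radius_speed y \<le> sqrt ?M * y" if y: "y \<in> radii" for y
  proof -
    have w: "0 \<le> height_speed y" "height_speed y \<le> 1"
      using y height_speed_nonneg height_speed_le_1 by auto
    have "height_speed y ^ (n - 1) = K * y ^ (n - 1) - C"
      using y height_speed_power[of y] by (simp add: radii_iff)
    moreover have "height_speed y ^ (n - 1) \<le> (height_speed y)\<^sup>2"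
      using w n by (intro power_decreasing) auto
    ultimately have "1 - (height_speed y)\<^sup>2 \<le> - K * y ^ (n - 1)"
      using C by linarith
    also have "n - 1 = (n - 3) + 2"
      using n by simp
    also have "y ^ ((n - 3) + 2) = y ^ (n - 3) * y\<^sup>2"
      by (rule power_add)
    also have "- K * (y ^ (n - 3) * y\<^sup>2) \<le> - K * (outer_radius ^ (n - 3) * y\<^sup>2)"
      using K radiiD[OF y] by (intro mult_left_mono mult_right_mono power_mono) auto
    finally have "radius_speed y \<le> sqrt (?M * y\<^sup>2)"
      unfolding radius_speed_def by (intro real_sqrt_le_mono) (simp add: mult.assoc)
    also have "\<dots> = sqrt ?M * y"
      using radiiD(3)[OF y] by (simp only: real_sqrt_mult real_sqrt_abs abs_of_nonneg)
    finally show ?thesis .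
  qed
qed

text \<open>The linear bound makes \<open>radius_time y - ln y / L\<close> nondecreasing, so
  \<open>radius_time\<close> lies below a multiple of the logarithm, up to a constant, and tends to
  minus infinity at the axis.\<close>

lemma times_eq_atMost:
  assumes C: "C = -1"
  shows "times = {..0}"
proof -
  obtain L where L: "0 < L" "\<And>y. y \<in> radii \<Longrightarrow> radius_speed y \<le> L * y"
    using radius_speed_linear_bound[OF C] by blast
  have inner: "inner_radius = 0"
    using C by (intro inner_radius_eq_0) simp
  have bound: "radius_time y \<le> (ln y - ln outer_radius) / L" if y: "y \<in> radii" for y
  proof -
    have "radius_time y - ln y / L \<le> radius_time outer_radius - ln outer_radius / L"
    proof (rule DERIV_nonneg_imp_increasing_open[where f = "\<lambda>z. radius_time z - ln z / L"])
      show "y \<le> outer_radius" using radiiD[OF y] by simp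
      have y0: "0 < y" using y C unfolding radii_def by blast
      show "continuous_on {y..outer_radius} (\<lambda>z. radius_time z - ln z / L)"
        using ivl_outer_subset_radii[OF y] y0 L(1)
        by (auto intro!: continuous_intros continuous_on_subset[OF continuous_on_radius_time])
      fix z assume z: "y < z" "z < outer_radius"
      then have z': "z \<in> {inner_radius<..<outer_radius}" "z \<in> radii" "0 < z"
        using y0 inner ivl_outer_subset_radii[OF y] by auto
      have speed: "0 < radius_speed z" "radius_speed z \<le> L * z"
        using z' L(2) by (auto intro: radius_speed_pos)
      have "((\<lambda>z. radius_time z - ln z / L) has_real_derivative 1 / radius_speed z - 1 / z / L) (at z)"
        using has_real_derivative_radius_time[OF z'(1)] z'(3) L(1)
        by (auto intro!: derivative_eq_intros)
      moreover have "1 / z / L \<le> 1 / radius_speed z"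
        using frac_le[of 1 1 "radius_speed z" "L * z"] speed by (simp add: mult.commute)
      ultimately show "\<exists>d. ((\<lambda>z. radius_time z - ln z / L) has_real_derivative d) (at z) \<and> 0 \<le> d"
        by (intro exI[of _ "1 / radius_speed z - 1 / z / L"]) simp
    qed
    then show ?thesis
      by (simp add: radius_time_outer diff_divide_distrib)
  qed
  have "s \<in> times" if "s \<le> 0" for s
  proof -
    \<comment> \<open>Solves \<open>(ln y - ln outer_radius) / L = s\<close>, so that
      \<open>radius_time y \<le> s\<close>; as \<open>times\<close> is an interval containing 0, it
      contains \<open>s\<close>.\<close>
    define y where "y = exp (L * s + ln outer_radius)"
    have "ln y \<le> ln outer_radius"
      using that L(1) by (simp add: y_def mult_nonneg_nonpos)
    moreover have y_pos: "0 < y"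
      by (simp add: y_def)
    ultimately have "y \<le> outer_radius"
      using outer_radius_pos ln_le_cancel_iff by blast
    with y_pos have y: "y \<in> radii"
      unfolding radii_def inner by simp
    have "radius_time y \<le> s"
      using bound[OF y] L(1) by (simp add: y_def)
    moreover have "radius_time y \<in> times"
      using y by (simp add: times_def)
    ultimately show ?thesis
      using is_interval_ivl_subset[OF is_interval_times _ zero_in_times, of "radius_time y"] that by auto
  qed
  then show ?thesis
    using times_nonpos by auto
qed

section \<open>Regularity of the inverse function\<close>

lemma continuous_on_time_radius: "continuous_on times time_radius"
proof -
  have "path_connected radii"
    using is_interval_radii is_interval_path_connected by blast
  then obtain g where g: "homeomorphism radii times radius_time g"
    using homeomorphism_into_1d[OF _ continuous_on_radius_time _ inj_on_radius_time] times_def by blast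
  then have "continuous_on times g" and "\<And>s. s \<in> times \<Longrightarrow> g s = time_radius s"
    by (auto simp: homeomorphism_def times_def)
  then show ?thesis
    by (metis continuous_on_cong)
qed

lemma interior_times_radius:
  assumes "s \<in> interior times"
  shows "time_radius s \<in> {inner_radius<..<outer_radius}"
proof -
  have s: "s \<in> times"
    using assms interior_subset by auto
  obtain e where e: "0 < e" "cball s e \<subseteq> times"
    using assms mem_interior_cball by blast
  have nbr: "s - e \<in> times" "s + e \<in> times"
    using e by (auto simp: subset_iff dist_real_def)
  have mono: "time_radius x < time_radius y" if "x \<in> times" "y \<in> times" "x < y" for x y
    using strict_mono_on_less[OF radius_time_strict_mono, of "time_radius x" "time_radius y"] that
    by (simp add: time_radius_in_radii)
  show ?thesis
    using mono[OF nbr(1) s] mono[OF s nbr(2)] e(1) radiiD[OF time_radius_in_radii[OF nbr(1)]]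
      radiiD[OF time_radius_in_radii[OF nbr(2)]] by auto
qed

text \<open>Inside, the inverse function theorem applies since the speed is nonzero. At the ends the
  derivative is the limit from inside, also at the turning point, where it is 0.\<close>

lemma has_real_derivative_time_radius:
  assumes "s \<in> times"
  shows "(time_radius has_real_derivative radius_speed (time_radius s)) (at s within times)"
proof (rule has_real_derivative_within_interval[OF is_interval_times continuous_on_time_radius _ _ assms])
  show "continuous_on times (\<lambda>s. radius_speed (time_radius s))"
    by (intro continuous_on_radius_speed continuous_on_time_radius)
  fix s assume s: "s \<in> interior times"
  obtain e where e: "0 < e" "ball s e \<subseteq> times"
    using s mem_interior by blast
  have "isCont time_radius s"
    using continuous_on_interior[OF continuous_on_time_radius s] .
  moreover have y: "time_radius s \<in> {inner_radius<..<outer_radius}"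
    by (rule interior_times_radius[OF s])
  moreover have "0 < radius_speed (time_radius s)"
    using y open_ivl_subset_radii by (intro radius_speed_pos) auto
  ultimately have "(time_radius has_real_derivative inverse (1 / radius_speed (time_radius s))) (at s)"
    using e by (intro DERIV_inverse_function[where f = radius_time and a = "s - e" and b = "s + e"]
        has_real_derivative_radius_time) (auto simp: subset_iff dist_real_def)
  then show "(time_radius has_real_derivative radius_speed (time_radius s)) (at s)"
    by simp
qed

text \<open>The differential equation solved for \<open>\<phi>''\<close>, with \<open>w\<close> in
  place of \<open>sqrt (1 - \<phi>'\<^sup>2)\<close>.\<close>

definition radius_accel :: "real \<Rightarrow> real"
  where "radius_accel y = - K * y ^ (n - 2) / height_speed y ^ (n - 3)"

text \<open>By \<open>w' = K * y ^ (n - 2) / w ^ (n - 2)\<close>. The denominator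
  \<open>radius_speed y\<close> is what the chain rule along \<open>time_radius\<close>
  cancels.\<close>

lemma has_real_derivative_radius_speed:
  assumes y: "y \<in> {inner_radius<..<outer_radius}"
  shows "(radius_speed has_real_derivative radius_accel y / radius_speed y) (at y)"
proof -
  let ?w = "height_speed y"
  have y': "y \<in> radii" "y < outer_radius"
    using y open_ivl_subset_radii by auto
  have w: "0 < ?w" "0 < radius_speed y"
    using height_speed_pos[OF y'] y radius_speed_pos[OF y'(1)] by auto
  have x: "0 < K * y ^ (n - 1) - C"
    using le_outer_radius_iff(2)[of y] y' by (simp add: radii_iff)
  have dw: "(height_speed has_real_derivative K * y ^ (n - 2) / ?w ^ (n - 2)) (at y)"
  proof -
    have "(root (n - 1) has_real_derivative inverse (real (n - 1) * ?w ^ (n - 1 - Suc 0)))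
        (at (K * y ^ (n - 1) - C))"
      unfolding height_speed_def using x by (intro DERIV_real_root) auto
    moreover have "((\<lambda>y. K * y ^ (n - 1) - C) has_real_derivative K * (real (n - 1) * y ^ (n - 1 - Suc 0))) (at y)"
      by (auto intro!: derivative_eq_intros)
    ultimately have "((\<lambda>y. root (n - 1) (K * y ^ (n - 1) - C)) has_real_derivative
        inverse (real (n - 1) * ?w ^ (n - 1 - Suc 0)) * (K * (real (n - 1) * y ^ (n - 1 - Suc 0)))) (at y)"
      by (rule DERIV_chain2)
    moreover have "n - 1 - Suc 0 = n - 2" by simp
    moreover have "inverse (m * W) * (K * (m * Y)) = K * Y / W" if "m \<noteq> 0" for m W Y :: real
      using that by (simp add: field_simps)
    moreover have "real (n - 1) \<noteq> 0"
      using n by simp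
    ultimately show ?thesis
      by (simp only: height_speed_def[abs_def] not_False_eq_True)
  qed
  have "1 - ?w\<^sup>2 = (radius_speed y)\<^sup>2"
    using speeds_square[OF y'(1)] by simp
  then have pos: "0 < 1 - ?w\<^sup>2"
    using w by simp
  have "((\<lambda>y. sqrt (1 - (height_speed y)\<^sup>2)) has_real_derivative
      - (2 * ?w * (K * y ^ (n - 2) / ?w ^ (n - 2))) * (inverse (sqrt (1 - ?w\<^sup>2)) / 2)) (at y)"
    using pos by (auto intro!: derivative_eq_intros dw)
  moreover have "n - 2 = Suc (n - 3)"
    using n by simp
  then have "?w ^ (n - 2) = ?w * ?w ^ (n - 3)"
    by (simp only: power_Suc)
  ultimately show ?thesis
    using w by (simp add: radius_speed_def[abs_def] radius_accel_def field_simps)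
qed

text \<open>After the cancellation the derivative is \<open>radius_accel\<close>, which is
  continuous also at the turning point, so the second derivative exists there. Time 0 is excluded:
  there \<open>w = 0\<close>, and for \<open>n > 3\<close> the acceleration is infinite.\<close>

lemma has_real_derivative_radius_speed_time_radius:
  assumes s: "s \<in> times" "s \<noteq> 0"
  shows "((\<lambda>s. radius_speed (time_radius s)) has_real_derivative radius_accel (time_radius s))
    (at s within times)"
proof -
  let ?S = "times \<inter> {..<0}"
  have S: "is_interval ?S"
    by (intro is_interval_Int is_interval_times is_interval_io)
  have cont: "continuous_on ?S time_radius"
    using continuous_on_time_radius continuous_on_subset by blast
  have below: "height_speed (time_radius s) \<noteq> 0" if "s \<in> ?S" for s
  proof -
    have "time_radius s \<noteq> outer_radius"
    proof
      assume "time_radius s = outer_radius"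
      then have "radius_time (time_radius s) = 0"
        by (simp only: radius_time_outer)
      with that show False by simp
    qed
    then show ?thesis
      using that height_speed_pos[of "time_radius s"] time_radius_in_radii[of s] radiiD(2)[of "time_radius s"]
      by force
  qed
  have "((\<lambda>s. radius_speed (time_radius s)) has_real_derivative radius_accel (time_radius s))
      (at s within ?S)"
  proof (rule has_real_derivative_within_interval[OF S])
    show "continuous_on ?S (\<lambda>s. radius_speed (time_radius s))"
      by (intro continuous_intros cont)
    show "continuous_on ?S (\<lambda>s. radius_accel (time_radius s))"
      unfolding radius_accel_def by (intro continuous_intros cont) (use below in auto)
    show "s \<in> ?S"
      using s times_nonpos by force
    fix s assume "s \<in> interior ?S"
    then have s: "s \<in> interior times" by simp
    then have y: "time_radius s \<in> {inner_radius<..<outer_radius}"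
      by (rule interior_times_radius)
    then have pos: "radius_speed (time_radius s) \<noteq> 0"
      using open_ivl_subset_radii by (intro radius_speed_nz) auto
    have "s \<in> times"
      using s interior_subset by blast
    then have "(time_radius has_real_derivative radius_speed (time_radius s)) (at s)"
      using has_real_derivative_time_radius[of s] s by (simp add: at_within_interior[of s times])
    from DERIV_chain2[OF has_real_derivative_radius_speed[OF y] this] pos
    show "((\<lambda>s. radius_speed (time_radius s)) has_real_derivative radius_accel (time_radius s)) (at s)"
      by simp
  qed
  moreover have "at s within times = at s within ?S"
    by (rule at_within_nhd[of s "{..<0}"]) (use s times_nonpos in force)+
  ultimately show ?thesis by simp
qed

text \<open>Here \<open>p\<close> stands for \<open>\<phi>'\<close>. Only its square enters, so
  rising and falling branches are treated at once.\<close>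

lemma radius_accel_ode:
  assumes "y \<in> radii" "y < outer_radius" "(p::real)\<^sup>2 = (radius_speed y)\<^sup>2"
  shows "K * y ^ (n - 2) = - radius_accel y * sqrt (1 - p\<^sup>2) ^ (n - 3)"
  using assms height_speed_pos[of y] by (simp add: sqrt_radius_speed radius_accel_def)

lemma radii_first_integral:
  assumes "y \<in> radii" "(p::real)\<^sup>2 = (radius_speed y)\<^sup>2"
  shows "K * y ^ (n - 1) = sqrt (1 - p\<^sup>2) ^ (n - 1) + C"
  unfolding assms(2) sqrt_radius_speed[OF assms(1)]
  using assms(1) height_speed_power[of y] by (simp add: radii_iff)

subsection \<open>Solutions built from branches\<close>

text \<open>The integral is a difference of values of \<open>radius_time\<close>, and the sign
  cancels by \<open>\<sigma> * \<sigma> = 1\<close>.\<close>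

lemma inverse_formula_radius_time:
  assumes radii: "\<And>t. t \<in> J \<Longrightarrow> \<phi> t \<in> radii" and \<sigma>: "\<sigma> \<in> {-1, 1}"
    and time: "\<And>t. t \<in> J \<Longrightarrow> radius_time (\<phi> t) = \<sigma> * (t - c)"
  shows "inverse_formula n K C \<sigma> J \<phi>"
  unfolding inverse_formula_def
proof (intro conjI ballI)
  show "inj_on \<phi> J"
    using \<sigma> time by (intro inj_onI) (metis diff_add_cancel insertE mult_minus1 mult_1 neg_equal_iff_equal singletonD)
  fix t\<^sub>0 t assume t: "t\<^sub>0 \<in> J" "t \<in> J"
  show "interval_lebesgue_integrable lborel (ereal (\<phi> t\<^sub>0)) (ereal (\<phi> t)) (quad_integrand n K C)"
    using quad_integrable_between_radii[OF radii[OF t(1)] radii[OF t(2)]]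
    by (simp add: quad_integrable_between_def)
  have "(LBINT y=ereal (\<phi> t\<^sub>0)..ereal (\<phi> t). \<sigma> * quad_integrand n K C y) = \<sigma> * quad_time n K C (\<phi> t\<^sub>0) (\<phi> t)"
    by (simp add: quad_time_def)
  also have "\<dots> = \<sigma> * (\<sigma> * (t - c) - \<sigma> * (t\<^sub>0 - c))"
    using t by (simp add: quad_time_radii radii time)
  also have "\<dots> = t - t\<^sub>0"
    using \<sigma> by auto
  finally show "t - t\<^sub>0 = (LBINT y=ereal (\<phi> t\<^sub>0)..ereal (\<phi> t). \<sigma> * quad_integrand n K C y)" ..
qed

lemma inverse_formula_time_radius:
  assumes "\<sigma> \<in> {-1, 1}"
    and "\<And>t. t \<in> J \<Longrightarrow> \<sigma> * (t - c) \<in> times \<and> \<Phi> t = time_radius (\<sigma> * (t - c))"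
  shows "inverse_formula n K C \<sigma> J \<Phi>"
  using assms by (intro inverse_formula_radius_time[where c = c]) (auto simp: time_radius_in_radii)

lemma time_radius_less_outer: "s \<in> times \<Longrightarrow> s \<noteq> 0 \<Longrightarrow> time_radius s < outer_radius"
  using radiiD(2)[OF time_radius_in_radii, of s] radius_time_time_radius[of s] radius_time_outer
  by (metis order_le_less)

text \<open>The sign enters the second derivative squared, so both branches have the same
  acceleration. At time \<open>c\<close> the branch has the outer radius, where the acceleration may
  be infinite.\<close>

lemma has_real_derivative_branch:
  assumes \<sigma>: "\<sigma> \<in> {-1, 1}" and t: "t \<in> S"
    and branch: "\<And>u. u \<in> S \<Longrightarrow> \<sigma> * (u - c) \<in> times \<and> \<Phi> u = time_radius (\<sigma> * (u - c))"
  shows "(\<Phi> has_real_derivative \<sigma> * radius_speed (\<Phi> t)) (at t within S)"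
    and "t \<noteq> c \<Longrightarrow> ((\<lambda>u. \<sigma> * radius_speed (\<Phi> u)) has_real_derivative radius_accel (\<Phi> t)) (at t within S)"
proof -
  show "(\<Phi> has_real_derivative \<sigma> * radius_speed (\<Phi> t)) (at t within S)"
    using has_real_derivative_affine_within[OF has_real_derivative_time_radius t branch] branch[OF t]
    by simp
  assume "t \<noteq> c"
  then have "\<sigma> * (t - c) \<noteq> 0"
    using \<sigma> by auto
  then have "((\<lambda>u. radius_speed (\<Phi> u)) has_real_derivative \<sigma> * radius_accel (\<Phi> t)) (at t within S)"
    using has_real_derivative_affine_within[OF has_real_derivative_radius_speed_time_radius t,
        where g = "\<lambda>u. radius_speed (\<Phi> u)"] branch t by simp
  from DERIV_cmult[OF this, of \<sigma>] show
    "((\<lambda>u. \<sigma> * radius_speed (\<Phi> u)) has_real_derivative radius_accel (\<Phi> t)) (at t within S)"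
    using \<sigma> by auto
qed

lemma curvature_solution_profile:
  assumes radii: "\<And>t. t \<in> S \<Longrightarrow> \<Phi> t \<in> radii"
    and \<Phi>: "\<And>t. t \<in> S \<Longrightarrow> (\<Phi> has_real_derivative \<Phi>' t) (at t within S)"
    and speed: "\<And>t. t \<in> S \<Longrightarrow> (\<Phi>' t)\<^sup>2 = (radius_speed (\<Phi> t))\<^sup>2"
    and \<Phi>': "\<And>t. t \<in> interior S \<Longrightarrow> \<Phi> t < outer_radius \<and>
      (\<Phi>' has_real_derivative radius_accel (\<Phi> t)) (at t within S)"
    and \<Psi>: "\<And>t. (\<Psi> has_real_derivative height_speed (\<Phi> t)) (at t)"
  shows "curvature_solution n K C S \<Phi> \<Phi>' \<Psi> (\<lambda>t. height_speed (\<Phi> t))"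
  unfolding curvature_solution_def
proof (intro conjI)
  show "generating_curve S \<Phi> \<Phi>' \<Psi> (\<lambda>t. height_speed (\<Phi> t))"
    unfolding generating_curve_def
    using radii \<Phi> speed by (simp add: radiiD(3) has_field_derivative_at_within[OF \<Psi>] speeds_square height_speed_nonneg)
  show "curvature_ode n K S \<Phi> \<Phi>'"
    unfolding curvature_ode_def
  proof
    fix t assume t: "t \<in> interior S"
    then have t': "t \<in> S" using interior_subset by blast
    with t show "\<exists>D. (\<Phi>' has_real_derivative D) (at t) \<and>
        K * \<Phi> t ^ (n - 2) = - D * sqrt (1 - (\<Phi>' t)\<^sup>2) ^ (n - 3)"
      using \<Phi>'[OF t] radius_accel_ode[OF radii[OF t'] _ speed[OF t']]
      by (intro exI[of _ "radius_accel (\<Phi> t)"]) (auto simp: at_within_interior[of t S])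
  qed
  show "first_integral n K C S \<Phi> \<Phi>'"
    unfolding first_integral_def using radii_first_integral radii speed by blast
qed

lemma curvature_solution_single_branch:
  assumes branch: "\<And>t. t \<le> c \<Longrightarrow> t - c \<in> times \<and> \<Phi> t = time_radius (t - c)"
    and \<Psi>: "\<And>t. (\<Psi> has_real_derivative height_speed (\<Phi> t)) (at t)"
  shows "curvature_solution n K C {..c} \<Phi> (\<lambda>t. radius_speed (\<Phi> t)) \<Psi> (\<lambda>t. height_speed (\<Phi> t))"
proof (rule curvature_solution_profile[OF _ _ _ _ \<Psi>])
  have branch': "1 * (t - c) \<in> times \<and> \<Phi> t = time_radius (1 * (t - c))" if "t \<in> {..c}" for t
    using branch that by simp
  show "\<Phi> t \<in> radii" if "t \<in> {..c}" for t
    using branch[of t] that time_radius_in_radii by simp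
  show "(\<Phi> has_real_derivative radius_speed (\<Phi> t)) (at t within {..c})" if "t \<in> {..c}" for t
    using has_real_derivative_branch(1)[OF _ that branch'] by simp
  show "\<Phi> t < outer_radius \<and>
      ((\<lambda>t. radius_speed (\<Phi> t)) has_real_derivative radius_accel (\<Phi> t)) (at t within {..c})"
    if "t \<in> interior {..c}" for t
  proof -
    from that have t: "t \<in> {..c}" "t \<noteq> c"
      by auto
    then show ?thesis
      using has_real_derivative_branch(2)[OF _ t(1) branch'] branch[of t] time_radius_less_outer[of "t - c"]
      by simp
  qed
qed simp

text \<open>The intervals can meet only at \<open>mid\<close>, and only for \<open>C < -1\<close>.
  There both branches have speed 0 and the same acceleration, so they fit together to second
  order.\<close>

lemma curvature_solution_two_branches:
  fixes mid h :: real
  defines "T \<equiv> quad_time n K C inner_radius outer_radius"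
  assumes C: "C \<noteq> -1" and h: "T \<le> h" "-1 < C \<Longrightarrow> T < h"
    and left: "\<And>t. t \<in> {mid - h..mid - h + T} \<Longrightarrow> \<Phi> t = time_radius (mid - h - t)"
    and right: "\<And>t. t \<in> {mid + h - T..mid + h} \<Longrightarrow> \<Phi> t = time_radius (t - (mid + h))"
    and \<Psi>: "\<And>t. (\<Psi> has_real_derivative height_speed (\<Phi> t)) (at t)"
  shows "\<exists>\<Phi>'. curvature_solution n K C ({mid - h..mid - h + T} \<union> {mid + h - T..mid + h})
    \<Phi> \<Phi>' \<Psi> (\<lambda>t. height_speed (\<Phi> t))"
proof -
  let ?L = "{mid - h..mid - h + T}" and ?R = "{mid + h - T..mid + h}"
  have times: "times = {- T..0}"
    unfolding T_def by (rule times_eq_atLeastAtMost[OF C])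
  have T: "0 \<le> T"
    unfolding T_def by (rule quad_time_inner_nonneg[OF C])
  have L: "-1 * (t - (mid - h)) \<in> times \<and> \<Phi> t = time_radius (-1 * (t - (mid - h)))" if "t \<in> ?L" for t
    using left[OF that] that by (simp add: times)
  have R: "1 * (t - (mid + h)) \<in> times \<and> \<Phi> t = time_radius (1 * (t - (mid + h)))" if "t \<in> ?R" for t
    using right[OF that] that by (simp add: times)
  define \<Phi>' where "\<Phi>' t = (if t \<le> mid - h + T then - 1 else 1) * radius_speed (\<Phi> t)" for t
  have \<Phi>'_L: "\<Phi>' t = - 1 * radius_speed (\<Phi> t)" if "t \<in> ?L" for t
    using that by (simp add: \<Phi>'_def)
  have \<Phi>'_R: "\<Phi>' t = 1 * radius_speed (\<Phi> t)" if t: "t \<in> ?R" for t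
  proof (cases "t \<le> mid - h + T")
    \<comment> \<open>A point of both intervals. The definition of \<open>\<Phi>'\<close> picks the
      sign of the left branch here, which is harmless because the speed is 0.\<close>
    case True
    with t h(1) have eq: "t = mid" "h = T"
      by auto
    with h(2) C have "C < -1"
      by (cases "-1 < C") auto
    have "inner_radius \<in> radii"
      using inner_less_outer C by (simp add: radii_def)
    then have "time_radius (- T) = inner_radius"
      using time_radius_radius_time[of inner_radius] by (simp add: radius_time_def T_def)
    then have "\<Phi> t = inner_radius"
      using R[OF t] eq by simp
    then show ?thesis
      using \<open>C < -1\<close> radius_speed_inner by (simp add: \<Phi>'_def)
  qed (simp add: \<Phi>'_def)
  have "curvature_solution n K C (?L \<union> ?R) \<Phi> \<Phi>' \<Psi> (\<lambda>t. height_speed (\<Phi> t))"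
  proof (rule curvature_solution_profile[OF _ _ _ _ \<Psi>])
    fix t
    show "\<Phi> t \<in> radii" if "t \<in> ?L \<union> ?R"
      using that L[of t] R[of t] time_radius_in_radii by auto
    show "(\<Phi>' t)\<^sup>2 = (radius_speed (\<Phi> t))\<^sup>2"
      by (simp add: \<Phi>'_def)
    show "(\<Phi> has_real_derivative \<Phi>' t) (at t within ?L \<union> ?R)"
    proof (rule has_real_derivative_within_Un_closed)
      show "(\<Phi> has_real_derivative \<Phi>' t) (at t within ?L)" if "t \<in> ?L"
        unfolding \<Phi>'_L[OF that] by (rule has_real_derivative_branch(1)[OF _ that L]) simp
      show "(\<Phi> has_real_derivative \<Phi>' t) (at t within ?R)" if "t \<in> ?R"
        unfolding \<Phi>'_R[OF that] by (rule has_real_derivative_branch(1)[OF _ that R]) simp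
    qed simp_all
    assume t: "t \<in> interior (?L \<union> ?R)"
    \<comment> \<open>Interior points avoid \<open>mid - h\<close> and \<open>mid + h\<close>, the
      times of the outer radius.\<close>
    have "?L \<union> ?R \<subseteq> {mid - h..mid + h}"
      using T h by auto
    then have "t \<in> interior {mid - h..mid + h}"
      using t interior_mono by blast
    then have t': "mid - h \<noteq> t" "t \<noteq> mid + h"
      by auto
    have "t \<in> ?L \<union> ?R"
      using t interior_subset by blast
    then have "\<Phi> t < outer_radius"
      using L[of t] R[of t] t' time_radius_less_outer by auto
    moreover have "(\<Phi>' has_real_derivative radius_accel (\<Phi> t)) (at t within ?L \<union> ?R)"
    proof (rule has_real_derivative_within_Un_closed)
      show "(\<Phi>' has_real_derivative radius_accel (\<Phi> t)) (at t within ?L)" if "t \<in> ?L"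
        by (rule has_field_derivative_transform_within[OF has_real_derivative_branch(2)[OF _ that L t'(1)[symmetric]]
              zero_less_one that]) (simp_all add: \<Phi>'_L)
      show "(\<Phi>' has_real_derivative radius_accel (\<Phi> t)) (at t within ?R)" if "t \<in> ?R"
        by (rule has_field_derivative_transform_within[OF has_real_derivative_branch(2)[OF _ that R t'(2)]
              zero_less_one that]) (simp_all add: \<Phi>'_R)
    qed simp_all
    ultimately show "\<Phi> t < outer_radius \<and>
        (\<Phi>' has_real_derivative radius_accel (\<Phi> t)) (at t within ?L \<union> ?R)" ..
  qed
  then show ?thesis by blast
qed

end

subsection \<open>Given solutions and their extension\<close>

text \<open>The hypothesis \<open>nondegenerate\<close> excludes the zero radius, which for
  \<open>C = -1\<close> satisfies all the equations but only describes the axis.\<close>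

locale negative_curvature_solution = negative_curvature_profile +
  fixes I :: "real set" and \<phi> \<phi>' \<psi> \<psi>' :: "real \<Rightarrow> real"
  assumes I: "is_interval I" "interior I \<noteq> {}"
    and sol: "curvature_solution n K C I \<phi> \<phi>' \<psi> \<psi>'"
    and nondegenerate: "\<exists>t\<in>I. \<phi> t \<noteq> 0"
begin

lemma reflected: "negative_curvature_solution n K C (uminus ` I) (\<lambda>t. \<phi> (- t)) (\<lambda>t. - \<phi>' (- t))
  (\<lambda>t. - \<psi> (- t)) (\<lambda>t. \<psi>' (- t))"
proof
  show "is_interval (uminus ` I)"
    using I(1) by simp
  show "interior (uminus ` I) \<noteq> {}"
    using I(2) by (simp add: interior_negations)
  show "curvature_solution n K C (uminus ` I) (\<lambda>t. \<phi> (- t)) (\<lambda>t. - \<phi>' (- t))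
      (\<lambda>t. - \<psi> (- t)) (\<lambda>t. \<psi>' (- t))"
    by (rule curvature_solution_reflect[OF sol])
  show "\<exists>t\<in>uminus ` I. \<phi> (- t) \<noteq> 0"
    using nondegenerate by auto
qed

lemma curve:
  assumes "t \<in> I"
  shows "0 \<le> \<phi> t" "(\<phi> has_real_derivative \<phi>' t) (at t within I)"
    "(\<psi> has_real_derivative \<psi>' t) (at t within I)"
    "(\<phi>' t)\<^sup>2 + (\<psi>' t)\<^sup>2 = 1" "0 \<le> \<psi>' t"
  using sol assms unfolding curvature_solution_def generating_curve_def by auto

lemma curve_power:
  assumes "t \<in> I"
  shows "\<psi>' t ^ (n - 1) = K * \<phi> t ^ (n - 1) - C"
proof -
  have "sqrt (1 - (\<phi>' t)\<^sup>2) = \<psi>' t"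
    using curve(4,5)[OF assms] by (intro real_sqrt_unique) auto
  then show ?thesis
    using sol assms unfolding curvature_solution_def first_integral_def by simp
qed

lemma curve_height_speed: "t \<in> I \<Longrightarrow> \<psi>' t = height_speed (\<phi> t)"
  unfolding height_speed_def curve_power[symmetric] using curve(5) by (simp add: real_root_power_cancel)

lemma curve_radius_speed:
  assumes "t \<in> I"
  shows "\<bar>\<phi>' t\<bar> = radius_speed (\<phi> t)"
proof -
  have "1 - (\<psi>' t)\<^sup>2 = (\<phi>' t)\<^sup>2"
    using curve(4)[OF assms] by simp
  then show ?thesis
    unfolding radius_speed_def curve_height_speed[OF assms, symmetric] by simp
qed

lemma curve_deriv:
  assumes "t \<in> interior I"
  shows "(\<phi> has_real_derivative \<phi>' t) (at t)"
  using curve(2)[of t] assms interior_subset by (auto simp: at_within_interior[of t I])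

lemma continuous_on_curve: "S \<subseteq> I \<Longrightarrow> continuous_on S \<phi>"
  using DERIV_continuous_on[OF curve(2)] continuous_on_subset by blast

text \<open>Stated for nonzero radii first, because the proof that the radius cannot vanish for
  \<open>C = -1\<close> applies the speed bound on \<open>radii\<close>.\<close>

lemma curve_in_radii_if_nonzero:
  assumes "t \<in> I" "C = -1 \<longrightarrow> \<phi> t \<noteq> 0"
  shows "\<phi> t \<in> radii"
proof -
  have "\<psi>' t \<le> 1"
    using curve(4,5)[OF assms(1)] by (metis le_add_same_cancel2 power2_le_imp_le one_power2 zero_le_power2 zero_le_one)
  then show ?thesis
    using assms curve(1,5)[OF assms(1)] unfolding radii_iff curve_power[OF assms(1), symmetric]
    by (simp add: power_le_one)
qed

text \<open>A Gronwall argument: if \<open>C = -1\<close>, then \<open>\<bar>\<phi>'\<bar> \<le> L \<phi>\<close>, so that \<open>\<phi> exp (L t)\<close> is increasing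
  and \<open>\<phi> exp (- L t)\<close> is decreasing.\<close>

lemma curve_nonzero:
  assumes C: "C = -1" and t: "t \<in> I"
  shows "\<phi> t \<noteq> 0"
proof -
  obtain L where L: "\<And>y. y \<in> radii \<Longrightarrow> radius_speed y \<le> L * y"
    using radius_speed_linear_bound[OF C] by blast
  have bound: "\<bar>\<phi>' s\<bar> \<le> L * \<phi> s" if s: "s \<in> I" for s
  proof (cases "\<phi> s = 0")
    case True
    have "radius_speed 0 = 0"
      unfolding radius_speed_def height_speed_def using C by (simp add: zero_power)
    with True curve_radius_speed[OF s] show ?thesis by simp
  next
    case False
    then show ?thesis
      unfolding curve_radius_speed[OF s] by (intro L curve_in_radii_if_nonzero s) auto
  qed
  obtain s where s: "s \<in> I" "\<phi> s \<noteq> 0"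
    using nondegenerate by blast
  then have s_pos: "0 < \<phi> s"
    using curve(1)[of s] by simp
  have deriv: "((\<lambda>x. c * \<phi> x * exp (a * x)) has_real_derivative c * (\<phi>' x + a * \<phi> x) * exp (a * x)) (at x)"
    if "x \<in> interior I" for x a c
    using curve_deriv[OF that] by (auto intro!: derivative_eq_intros simp: algebra_simps)
  have cont: "continuous_on {x..y} (\<lambda>x. c * \<phi> x * exp (a * x))" if "x \<in> I" "y \<in> I" for x y a c
    using is_interval_ivl_subset[OF I(1) that] by (intro continuous_intros continuous_on_curve)
  have int: "x \<in> interior I" "x \<in> I" if "u \<in> I" "v \<in> I" "u < x" "x < v" for u v x
    using is_interval_open_ivl_subset_interior[OF I(1), of u v] that interior_subset[of I] by auto
  consider "s = t" | "s < t" | "t < s" by linarith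
  then show ?thesis
  proof cases
    case 2
    have "1 * \<phi> s * exp (L * s) \<le> 1 * \<phi> t * exp (L * t)"
    proof (rule DERIV_nonneg_imp_increasing_open[where f = "\<lambda>x. 1 * \<phi> x * exp (L * x)"])
      fix x assume "s < x" "x < t"
      then have x: "x \<in> interior I" "x \<in> I"
        using int[OF s(1) t] by auto
      then show "\<exists>d. ((\<lambda>x. 1 * \<phi> x * exp (L * x)) has_real_derivative d) (at x) \<and> 0 \<le> d"
        using deriv[OF x(1), of 1 L] bound[OF x(2)] by (intro exI conjI) (auto simp: abs_le_iff)
    qed (use 2 cont[OF s(1) t, of 1 L] in auto)
    then show ?thesis
      using s_pos by (auto simp: mult_le_0_iff)
  next
    case 3
    have "- 1 * \<phi> t * exp (- L * t) \<le> - 1 * \<phi> s * exp (- L * s)"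
    proof (rule DERIV_nonneg_imp_increasing_open[where f = "\<lambda>x. - 1 * \<phi> x * exp (- L * x)"])
      fix x assume "t < x" "x < s"
      then have x: "x \<in> interior I" "x \<in> I"
        using int[OF t s(1)] by auto
      then show "\<exists>d. ((\<lambda>x. - 1 * \<phi> x * exp (- L * x)) has_real_derivative d) (at x) \<and> 0 \<le> d"
        using deriv[OF x(1), of "- 1" "- L"] bound[OF x(2)] by (intro exI conjI) (auto simp: abs_le_iff)
    qed (use 3 cont[OF t s(1), of "- 1" "- L"] in auto)
    then show ?thesis
      using s_pos by (auto simp: mult_le_0_iff)
  qed (use s in auto)
qed

lemma curve_in_radii: "t \<in> I \<Longrightarrow> \<phi> t \<in> radii"
  using curve_in_radii_if_nonzero curve_nonzero by blast

text \<open>On \<open>radii\<close> the radius speed vanishes only at the inner radius, and only for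
  \<open>C < -1\<close>.\<close>

lemma critical_point:
  assumes "t \<in> I" "\<phi>' t = 0"
  shows "C < -1" "\<phi> t = inner_radius"
proof -
  have "radius_speed (\<phi> t) = 0"
    using curve_radius_speed[OF assms(1)] assms(2) by simp
  then show "C < -1" "\<phi> t = inner_radius"
    using radius_speed_nz[OF curve_in_radii[OF assms(1)]] radiiD(1)[OF curve_in_radii[OF assms(1)]]
    by force+
qed

text \<open>A constant radius on an open interval would give \<open>\<phi>'' = 0\<close> there, hence \<open>\<phi> = 0\<close> by the
  differential equation.\<close>

lemma not_constant:
  assumes st: "s \<in> I" "t \<in> I" "s < t" and const: "\<And>x. s < x \<Longrightarrow> x < t \<Longrightarrow> \<phi> x = c"
  shows False
proof -
  have sub: "{s<..<t} \<subseteq> interior I"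
    by (rule is_interval_open_ivl_subset_interior[OF I(1) st(1,2)])
  have \<phi>'_0: "\<phi>' x = 0" if x: "x \<in> {s<..<t}" for x
  proof -
    have "(\<phi> has_real_derivative 0) (at x)"
      by (rule has_field_derivative_transform_within_open[of "\<lambda>_. c" _ _ "{s<..<t}"])
        (use x const in auto)
    moreover have "(\<phi> has_real_derivative \<phi>' x) (at x)"
      using curve_deriv sub x by blast
    ultimately show ?thesis
      using DERIV_unique by blast
  qed
  obtain x where x: "x \<in> {s<..<t}"
    using dense[OF st(3)] by auto
  with sub have "x \<in> interior I" by blast
  with sol obtain D where D: "(\<phi>' has_real_derivative D) (at x)"
    "K * \<phi> x ^ (n - 2) = - D * sqrt (1 - (\<phi>' x)\<^sup>2) ^ (n - 3)"
    unfolding curvature_solution_def curvature_ode_def by blast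
  have "(\<phi>' has_real_derivative 0) (at x)"
    by (rule has_field_derivative_transform_within_open[of "\<lambda>_. 0" _ _ "{s<..<t}"])
      (use x \<phi>'_0 in auto)
  with D(1) have "D = 0"
    using DERIV_unique by blast
  with D(2) K n have "\<phi> x = 0"
    by simp
  moreover have "x \<in> I"
    using \<open>x \<in> interior I\<close> interior_subset by blast
  ultimately show False
    using critical_point[OF _ \<phi>'_0[OF x]] inner_radius_pos by auto
qed

text \<open>The derivative of \<open>radius_time (\<phi> t)\<close> is
  \<open>\<phi>' t / radius_speed (\<phi> t) = 1\<close> wherever \<open>\<phi>'\<close> is
  positive. Strict monotonicity keeps the radius strictly between the extreme ones inside
  \<open>{s..t}\<close>, so zeros of \<open>\<phi>'\<close> can occur only at its ends.\<close>

lemma increasing_time: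
  assumes J: "is_interval J" "J \<subseteq> I" and nonneg: "\<And>t. t \<in> J \<Longrightarrow> 0 \<le> \<phi>' t"
    and s: "s \<in> J" and t: "t \<in> J"
  shows "radius_time (\<phi> t) - radius_time (\<phi> s) = t - s"
  using s t
proof (induction s t rule: linorder_wlog)
  case (le s t)
  have sub: "{u..v} \<subseteq> I" "{u<..<v} \<subseteq> interior I" if "u \<in> J" "v \<in> J" for u v
    using is_interval_ivl_subset[OF I(1), of u v] is_interval_open_ivl_subset_interior[OF I(1), of u v]
      that J by auto
  have mono: "\<phi> u \<le> \<phi> v" if uv: "u \<in> J" "v \<in> J" "u \<le> v" for u v
  proof (rule DERIV_nonneg_imp_increasing_open[OF uv(3)])
    show "continuous_on {u..v} \<phi>"
      using uv by (intro continuous_on_curve sub)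
    fix x assume x: "u < x" "x < v"
    then have "x \<in> interior I" "x \<in> J"
      using sub(2)[OF uv(1,2)] is_interval_ivl_subset[OF J(1) uv(1,2)] by auto
    then show "\<exists>d. (\<phi> has_real_derivative d) (at x) \<and> 0 \<le> d"
      using curve_deriv nonneg by blast
  qed
  \<comment> \<open>A weakly increasing radius with no gain from \<open>u\<close> to
    \<open>v\<close> would be constant in between.\<close>
  have strict: "\<phi> u < \<phi> v" if uv: "u \<in> J" "v \<in> J" "u < v" for u v
  proof (rule ccontr)
    assume "\<not> \<phi> u < \<phi> v"
    moreover have "\<phi> u \<le> \<phi> x \<and> \<phi> x \<le> \<phi> v" if "u < x" "x < v" for x
    proof -
      have "x \<in> J"
        using is_interval_ivl_subset[OF J(1) uv(1,2)] that by auto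
      then show ?thesis
        using mono[of u x] mono[of x v] uv that by simp
    qed
    ultimately have "\<phi> x = \<phi> u" if "u < x" "x < v" for x
      using that by fastforce
    then show False
      using not_constant[of u v "\<phi> u"] uv J(2) by blast
  qed
  show ?case
  proof (cases "s = t")
    case False
    with le have st: "s < t" by simp
    have "radius_time (\<phi> t) - t = radius_time (\<phi> s) - s"
    proof (rule DERIV_isconst_end[OF st])
      have "\<phi> ` {s..t} \<subseteq> radii"
        using sub(1)[OF le(2,3)] curve_in_radii by blast
      then show "continuous_on {s..t} (\<lambda>x. radius_time (\<phi> x) - x)"
        using sub(1)[OF le(2,3)]
        by (intro continuous_intros continuous_on_compose2[OF continuous_on_radius_time] continuous_on_curve)
      fix x assume x: "s < x" "x < t"
      then have x': "x \<in> interior I" "x \<in> I" "x \<in> J"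
        using sub[OF le(2,3)] is_interval_ivl_subset[OF J(1) le(2,3)] by auto
      have "\<phi> s < \<phi> x" "\<phi> x < \<phi> t"
        using strict x x' le by auto
      then have y: "\<phi> x \<in> {inner_radius<..<outer_radius}"
        using radiiD(1)[OF curve_in_radii[of s]] radiiD(2)[OF curve_in_radii[of t]] le J(2) by force
      have "radius_speed (\<phi> x) = \<phi>' x"
        using curve_radius_speed[OF x'(2)] nonneg[OF x'(3)] by simp
      moreover have "\<phi>' x \<noteq> 0"
        using critical_point(2)[OF x'(2)] y by auto
      ultimately show "((\<lambda>x. radius_time (\<phi> x) - x) has_real_derivative 0) (at x)"
        using DERIV_diff[OF DERIV_chain2[OF has_real_derivative_radius_time[OF y] curve_deriv[OF x'(1)]] DERIV_ident]
        by simp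
    qed
    then show ?thesis by simp
  qed simp
next
  case (sym s t)
  then show ?case by simp
qed

lemma increasing_branch:
  assumes "is_interval J" "J \<subseteq> I" "\<And>t. t \<in> J \<Longrightarrow> 0 \<le> \<phi>' t"
  obtains c where "\<And>t. t \<in> J \<Longrightarrow> radius_time (\<phi> t) = 1 * (t - c)"
proof (cases "J = {}")
  case False
  then obtain s where "s \<in> J" by blast
  with increasing_time[OF assms, of s] show ?thesis
    using that[of "s - radius_time (\<phi> s)"] by force
qed (use that in simp)

lemma decreasing_branch:
  assumes J: "is_interval J" "J \<subseteq> I" "\<And>t. t \<in> J \<Longrightarrow> \<phi>' t \<le> 0"
  obtains c where "\<And>t. t \<in> J \<Longrightarrow> radius_time (\<phi> t) = - 1 * (t - c)"
proof -
  interpret R: negative_curvature_solution n K C "uminus ` I" "\<lambda>t. \<phi> (- t)" "\<lambda>t. - \<phi>' (- t)"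
    "\<lambda>t. - \<psi> (- t)" "\<lambda>t. \<psi>' (- t)"
    by (rule reflected)
  have J': "is_interval (uminus ` J)" "uminus ` J \<subseteq> uminus ` I"
    "\<And>t. t \<in> uminus ` J \<Longrightarrow> 0 \<le> - \<phi>' (- t)"
    using J by auto
  from R.increasing_branch[OF J'] obtain c where
    c: "\<And>t. t \<in> uminus ` J \<Longrightarrow> radius_time (\<phi> (- t)) = 1 * (t - c)" by blast
  show ?thesis
  proof (rule that)
    show "radius_time (\<phi> t) = - 1 * (t - - c)" if "t \<in> J" for t
      using c[of "- t"] that by simp
  qed
qed

lemma inverse_formula_curve:
  assumes J: "is_interval J" "J \<subseteq> I" and \<sigma>: "\<sigma> \<in> {-1, 1}" "\<And>t. t \<in> J \<Longrightarrow> 0 \<le> \<sigma> * \<phi>' t"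
  shows "inverse_formula n K C \<sigma> J \<phi>"
proof -
  obtain c where "\<And>t. t \<in> J \<Longrightarrow> radius_time (\<phi> t) = \<sigma> * (t - c)"
  proof (cases "\<sigma> = 1")
    case True
    then show ?thesis
      using increasing_branch[OF J] \<sigma>(2) that by auto
  next
    case False
    with \<sigma>(1) have "\<sigma> = -1" by simp
    then show ?thesis
      using decreasing_branch[OF J] \<sigma>(2) that by auto
  qed
  then show ?thesis
    using J \<sigma>(1) curve_in_radii by (intro inverse_formula_radius_time) auto
qed

section \<open>Turning points and the sign of the derivative\<close>

lemma other_point: "\<exists>s\<in>I. s \<noteq> t"
proof -
  have "infinite (interior I)"
    using I(2) finite_imp_not_open open_interior by blast
  then have "infinite I"
    using interior_subset infinite_super by blast
  then have "\<not> I \<subseteq> {t}"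
    using finite_subset by blast
  then show ?thesis by blast
qed

text \<open>A critical point has the least possible radius. No further one follows it, so the radius
  is injective and hence strictly monotone from there on, and it cannot decrease below its
  minimum.\<close>

lemma increasing_after_critical_point:
  assumes c: "c \<in> I" "\<phi>' c = 0" and t: "t \<in> I" "c \<le> t"
  shows "0 \<le> \<phi>' t"
proof (cases "t = c")
  case False
  let ?J = "I \<inter> {c..}"
  have J: "is_interval ?J"
    by (intro is_interval_Int I is_interval_ci)
  have deriv: "(\<phi> has_real_derivative \<phi>' x) (at x within ?J)" if "x \<in> ?J" for x
    using that curve(2)[of x] by (auto intro: has_field_derivative_subset)
  have noncritical: "\<phi>' s \<noteq> 0" if s: "s \<in> I" "c < s" for s
  proof
    assume s0: "\<phi>' s = 0"
    have sub: "{c..s} \<subseteq> I" "{c<..<s} \<subseteq> interior I"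
      using is_interval_ivl_subset[OF I(1) c(1) s(1)] is_interval_open_ivl_subset_interior[OF I(1) c(1) s(1)] .
    \<comment> \<open>A maximum point of the radius between two critical points is itself critical,
      so the maximum is the inner radius, which is also the minimum.\<close>
    obtain u where u: "u \<in> {c..s}" "\<And>x. x \<in> {c..s} \<Longrightarrow> \<phi> x \<le> \<phi> u"
      using continuous_attains_sup[of "{c..s}" \<phi>] continuous_on_curve[OF sub(1)] s(2) by auto
    have "\<phi>' u = 0"
    proof (cases "u = c \<or> u = s")
      case False
      with u(1) have u': "c < u" "u < s" by auto
      show ?thesis
      proof (rule DERIV_local_max)
        show "(\<phi> has_real_derivative \<phi>' u) (at u)"
          using curve_deriv sub(2) u' by auto
        show "0 < min (u - c) (s - u)" using u' by simp
        show "\<forall>x. \<bar>u - x\<bar> < min (u - c) (s - u) \<longrightarrow> \<phi> x \<le> \<phi> u"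
          by (intro allI impI u(2)) (auto simp: abs_if split: if_splits)
      qed
    qed (use c s0 in auto)
    then have max: "\<phi> u = inner_radius"
      using critical_point(2) u(1) sub(1) by blast
    have "\<phi> x = inner_radius" if "c < x" "x < s" for x
    proof -
      have "x \<in> {c..s}" using that by simp
      with u(2)[of x] max radiiD(1)[OF curve_in_radii[of x]] sub(1) show ?thesis by auto
    qed
    then show False
      using not_constant[OF c(1) s] by blast
  qed
  have "inj_on \<phi> ?J"
    by (rule nonzero_deriv_imp_inj_on[OF J deriv]) (use noncritical interior_subset[of I] in \<open>auto simp: interior_Int\<close>)
  then have "strict_mono_on ?J \<phi> \<or> strict_antimono_on ?J \<phi>"
    using injective_eq_monotone_map[OF J continuous_on_curve] by blast
  moreover have "\<not> strict_antimono_on ?J \<phi>"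
    using monotone_onD[of ?J "(<)" "(>)" \<phi> c t] c t False critical_point(2)[OF c]
      radiiD(1)[OF curve_in_radii[OF t(1)]] by auto
  ultimately have "mono_on ?J \<phi>"
    using strict_mono_on_imp_mono_on by blast
  then show ?thesis
    by (rule mono_on_imp_deriv_within_nonneg[OF _ J _ _ _ deriv, of t c]) (use c t False in auto)
qed (use c in simp)

lemma decreasing_before_critical_point:
  assumes c: "c \<in> I" "\<phi>' c = 0" and t: "t \<in> I" "t \<le> c"
  shows "\<phi>' t \<le> 0"
proof -
  interpret R: negative_curvature_solution n K C "uminus ` I" "\<lambda>t. \<phi> (- t)" "\<lambda>t. - \<phi>' (- t)"
    "\<lambda>t. - \<psi> (- t)" "\<lambda>t. \<psi>' (- t)"
    by (rule reflected)
  show ?thesis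
    using R.increasing_after_critical_point[of "- c" "- t"] c t by simp
qed

text \<open>Continuity of \<open>\<phi>'\<close> at the ends of \<open>I\<close> is not given, so
  the sign is obtained from strict monotonicity of \<open>\<phi>\<close> instead of the intermediate
  value theorem.\<close>

lemma constant_sign:
  assumes "\<And>t. t \<in> I \<Longrightarrow> \<phi>' t \<noteq> 0"
  shows "(\<forall>t\<in>I. 0 \<le> \<phi>' t) \<or> (\<forall>t\<in>I. \<phi>' t \<le> 0)"
proof -
  have nonneg: "\<forall>t\<in>I. 0 \<le> f' t"
    if "strict_mono_on I f" "\<And>t. t \<in> I \<Longrightarrow> (f has_real_derivative f' t) (at t within I)"
    for f f' :: "real \<Rightarrow> real"
    using mono_on_imp_deriv_within_nonneg[OF strict_mono_on_imp_mono_on[OF that(1)] I(1) _ _ _ that(2)]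
      other_point by metis
  have "inj_on \<phi> I"
    by (rule nonzero_deriv_imp_inj_on[OF I(1) curve(2)]) (use assms interior_subset in auto)
  then consider "strict_mono_on I \<phi>" | "strict_antimono_on I \<phi>"
    using injective_eq_monotone_map[OF I(1) continuous_on_curve] by blast
  then show ?thesis
  proof cases
    case 1
    then show ?thesis
      using nonneg[OF 1 curve(2)] by blast
  next
    case 2
    then have "strict_mono_on I (\<lambda>t. - \<phi> t)"
      by (simp add: monotone_on_def)
    from nonneg[OF this DERIV_minus[OF curve(2)]] show ?thesis by simp
  qed
qed

text \<open>The expression \<open>\<bar>t - mid\<bar> - h\<close> describes both branches at once:
  the falling one leaves the outer radius at \<open>mid - h\<close>, the rising one reaches it at
  \<open>mid + h\<close>.\<close>

lemma two_branch_time: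
  fixes h :: real
  defines "T \<equiv> quad_time n K C inner_radius outer_radius"
  assumes C: "C \<noteq> -1" and h: "T \<le> h" "C < -1 \<Longrightarrow> h = T"
  obtains mid where "\<And>t. t \<in> I \<Longrightarrow> radius_time (\<phi> t) = \<bar>t - mid\<bar> - h"
proof (cases "\<exists>c\<in>I. \<phi>' c = 0")
  case True
  then obtain c where c: "c \<in> I" "\<phi>' c = 0" by blast
  note crit = critical_point[OF c]
  have time_c: "radius_time (\<phi> c) = - h"
    using crit h by (simp add: radius_time_def T_def)
  obtain d where d: "\<And>t. t \<in> I \<inter> {c..} \<Longrightarrow> radius_time (\<phi> t) = 1 * (t - d)"
    using increasing_branch[of "I \<inter> {c..}"] increasing_after_critical_point[OF c] I(1)
    by (auto intro: is_interval_Int is_interval_ci)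
  obtain d' where d': "\<And>t. t \<in> I \<inter> {..c} \<Longrightarrow> radius_time (\<phi> t) = - 1 * (t - d')"
    using decreasing_branch[of "I \<inter> {..c}"] decreasing_before_critical_point[OF c] I(1)
    by (auto intro: is_interval_Int is_interval_ic)
  have "radius_time (\<phi> t) = \<bar>t - c\<bar> - h" if "t \<in> I" for t
    using d[of t] d[of c] d'[of t] d'[of c] time_c c that by (cases "c \<le> t") auto
  then show ?thesis by (rule that)
next
  case False
  have time: "- T \<le> radius_time (\<phi> t)" if "t \<in> I" for t
    using times_eq_atLeastAtMost[OF C] curve_in_radii[OF that] by (auto simp: times_def T_def)
  consider "\<And>t. t \<in> I \<Longrightarrow> 0 \<le> \<phi>' t" | "\<And>t. t \<in> I \<Longrightarrow> \<phi>' t \<le> 0"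
    using constant_sign False by blast
  then show ?thesis
  proof cases
    case 1
    from increasing_branch[OF I(1) subset_refl 1] obtain d where
      d: "\<And>t. t \<in> I \<Longrightarrow> radius_time (\<phi> t) = 1 * (t - d)" by blast
    \<comment> \<open>Only the rising branch is present, and \<open>d\<close> is its time of outer
      radius, to be \<open>mid + h\<close>. From \<open>- h \<le> - T \<le> t - d\<close> follows
      \<open>mid \<le> t\<close> on \<open>I\<close>.\<close>
    show ?thesis
      by (rule that[of "d - h"]) (use d time h(1) in \<open>force simp: abs_if\<close>)
  next
    case 2
    from decreasing_branch[OF I(1) subset_refl 2] obtain d where
      d: "\<And>t. t \<in> I \<Longrightarrow> radius_time (\<phi> t) = - 1 * (t - d)" by blast
    show ?thesis
      by (rule that[of "d + h"]) (use d time h(1) in \<open>force simp: abs_if\<close>)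
  qed
qed

section \<open>Extension of the given curve\<close>

lemma curve_extension:
  assumes I\<Phi>: "\<And>t. t \<in> I \<Longrightarrow> \<Phi> t = \<phi> t" and cont: "continuous_on UNIV \<Phi>"
  obtains \<Psi> where "\<And>t. (\<Psi> has_real_derivative height_speed (\<Phi> t)) (at t)" "\<And>t. t \<in> I \<Longrightarrow> \<Psi> t = \<psi> t"
proof -
  have "(\<psi> has_real_derivative height_speed (\<Phi> t)) (at t within I)" if "t \<in> I" for t
    using curve(3)[OF that] by (simp add: I\<Phi> that curve_height_speed)
  from antiderivative_extension[OF continuous_on_height_speed[OF cont] I(1) this] show ?thesis
    using that by blast
qed

lemma two_branch_extension:
  fixes a :: real
  defines "T \<equiv> quad_time n K C inner_radius outer_radius"
  assumes C: "C \<noteq> -1" and a: "a = root (n - 1) ((C + 1) / K)"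
  shows "\<exists>C' D' \<Phi> \<Phi>' \<Psi> \<Psi>'.
      I \<subseteq> {C'..C' + T} \<union> {D' - T..D'}
    \<and> (\<forall>t\<in>I. \<Phi> t = \<phi> t \<and> \<Psi> t = \<psi> t)
    \<and> curvature_solution n K C ({C'..C' + T} \<union> {D' - T..D'}) \<Phi> \<Phi>' \<Psi> \<Psi>'
    \<and> \<Phi> C' = outer_radius \<and> \<Phi> D' = outer_radius
    \<and> D' - C' = 2 * quad_time n K C a outer_radius
    \<and> inverse_formula n K C (-1) {C'..C' + T} \<Phi>
    \<and> inverse_formula n K C 1 {D' - T..D'} \<Phi>"
proof -
  \<comment> \<open>Half of the prescribed distance \<open>D' - C'\<close>.\<close>
  define h where "h = quad_time n K C a outer_radius"
  have h: "T \<le> h" "-1 < C \<Longrightarrow> T < h" "C < -1 \<Longrightarrow> h = T"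
    using quad_time_full[OF a] C by (auto simp: h_def T_def linorder_neq_iff)
  have T: "0 \<le> T"
    unfolding T_def by (rule quad_time_inner_nonneg[OF C])
  have times: "times = {- T..0}"
    unfolding T_def by (rule times_eq_atLeastAtMost[OF C])
  obtain mid where mid: "\<And>t. t \<in> I \<Longrightarrow> radius_time (\<phi> t) = \<bar>t - mid\<bar> - h"
    using two_branch_time[OF C] h unfolding T_def by metis
  \<comment> \<open>Clamping the argument to \<open>times\<close> makes the radius continuous on the
    whole line, so the height can be integrated across the gap between the branches too.\<close>
  define \<Phi> where "\<Phi> t = time_radius (max (- T) (min 0 (\<bar>t - mid\<bar> - h)))" for t
  have left: "-1 * (t - (mid - h)) \<in> times \<and> \<Phi> t = time_radius (-1 * (t - (mid - h)))"
    if "t \<in> {mid - h..mid - h + T}" for t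
  proof -
    have "max (- T) (min 0 (\<bar>t - mid\<bar> - h)) = -1 * (t - (mid - h))"
      using that h(1) by (auto simp: abs_if)
    with that show ?thesis by (auto simp: \<Phi>_def times)
  qed
  have right: "1 * (t - (mid + h)) \<in> times \<and> \<Phi> t = time_radius (1 * (t - (mid + h)))"
    if "t \<in> {mid + h - T..mid + h}" for t
  proof -
    have "max (- T) (min 0 (\<bar>t - mid\<bar> - h)) = 1 * (t - (mid + h))"
      using that h(1) by (auto simp: abs_if)
    with that show ?thesis by (auto simp: \<Phi>_def times)
  qed
  have in_times: "\<bar>t - mid\<bar> - h \<in> {- T..0}" if "t \<in> I" for t
    unfolding times[symmetric] mid[OF that, symmetric] using curve_in_radii[OF that] by (simp add: times_def)
  have \<Phi>_I: "\<Phi> t = \<phi> t" if "t \<in> I" for t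
  proof -
    have "\<Phi> t = time_radius (\<bar>t - mid\<bar> - h)"
      using in_times[OF that] by (simp add: \<Phi>_def max_absorb2 min_absorb2)
    then show ?thesis
      using curve_in_radii[OF that] by (simp flip: mid[OF that])
  qed
  have "continuous_on UNIV \<Phi>"
    unfolding \<Phi>_def using T
    by (intro continuous_on_compose2[OF continuous_on_time_radius] continuous_intros) (auto simp: times)
  from curve_extension[OF \<Phi>_I this] obtain \<Psi> where
    \<Psi>: "\<And>t. (\<Psi> has_real_derivative height_speed (\<Phi> t)) (at t)" "\<And>t. t \<in> I \<Longrightarrow> \<Psi> t = \<psi> t"
    by blast
  obtain \<Phi>' where sol: "curvature_solution n K C ({mid - h..mid - h + T} \<union> {mid + h - T..mid + h})
    \<Phi> \<Phi>' \<Psi> (\<lambda>t. height_speed (\<Phi> t))"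
    using curvature_solution_two_branches[OF C, of h mid \<Phi> \<Psi>] h(1,2) left right \<Psi>(1)
    unfolding T_def by auto
  have zero: "time_radius 0 = outer_radius"
    using time_radius_radius_time[OF outer_radius_in_radii] by (simp add: radius_time_outer)
  show ?thesis
  proof (intro exI conjI)
    show "I \<subseteq> {mid - h..mid - h + T} \<union> {mid + h - T..mid + h}"
      using in_times by (force simp: abs_if split: if_splits)
    show "\<forall>t\<in>I. \<Phi> t = \<phi> t \<and> \<Psi> t = \<psi> t"
      using \<Phi>_I \<Psi>(2) by blast
    show "\<Phi> (mid - h) = outer_radius" "\<Phi> (mid + h) = outer_radius"
      using left[of "mid - h"] right[of "mid + h"] T zero by auto
    show "mid + h - (mid - h) = 2 * quad_time n K C a outer_radius"
      by (simp add: h_def)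
    show "inverse_formula n K C (-1) {mid - h..mid - h + T} \<Phi>"
      by (rule inverse_formula_time_radius[OF _ left]) simp
    show "inverse_formula n K C 1 {mid + h - T..mid + h} \<Phi>"
      by (rule inverse_formula_time_radius[OF _ right]) simp
  qed (rule sol)
qed

lemma unbounded_extension:
  assumes C: "C = -1" and nonneg: "\<And>t. t \<in> I \<Longrightarrow> 0 \<le> \<phi>' t"
  shows "\<exists>S \<Phi> \<Phi>' \<Psi> \<Psi>'.
      is_interval S \<and> I \<subseteq> S \<and> \<not> bdd_below S
    \<and> (\<forall>t\<in>I. \<Phi> t = \<phi> t \<and> \<Psi> t = \<psi> t)
    \<and> curvature_solution n K C S \<Phi> \<Phi>' \<Psi> \<Psi>'
    \<and> inverse_formula n K C 1 S \<Phi>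
    \<and> \<not> bdd_below (\<Psi> ` S)"
proof -
  have times: "times = {..0}"
    by (rule times_eq_atMost[OF C])
  obtain c where c: "\<And>t. t \<in> I \<Longrightarrow> radius_time (\<phi> t) = 1 * (t - c)"
    using increasing_branch[OF I(1) subset_refl nonneg] by blast
  define \<Phi> where "\<Phi> t = time_radius (min 0 (t - c))" for t
  have branch: "t - c \<in> times \<and> \<Phi> t = time_radius (t - c)" if "t \<le> c" for t
    using that by (simp add: \<Phi>_def times)
  have sub: "t \<le> c" if "t \<in> I" for t
  proof -
    have "radius_time (\<phi> t) \<in> times"
      using curve_in_radii[OF that] by (simp add: times_def)
    then show ?thesis
      using times_nonpos c[OF that] by fastforce
  qed
  have \<Phi>_I: "\<Phi> t = \<phi> t" if "t \<in> I" for t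
    using branch[OF sub[OF that]] c[OF that] time_radius_radius_time[OF curve_in_radii[OF that]] by simp
  have cont: "continuous_on UNIV \<Phi>"
    unfolding \<Phi>_def
    by (intro continuous_on_compose2[OF continuous_on_time_radius] continuous_intros) (auto simp: times)
  from curve_extension[OF \<Phi>_I cont] obtain \<Psi> where
    \<Psi>: "\<And>t. (\<Psi> has_real_derivative height_speed (\<Phi> t)) (at t)" "\<And>t. t \<in> I \<Longrightarrow> \<Psi> t = \<psi> t"
    by blast
  \<comment> \<open>At \<open>c\<close> the outer radius is reached and the height speed is 0.
    Before \<open>c - 1\<close> the radius is smaller, so the height speed is at least its positive
    value at \<open>c - 1\<close>.\<close>
  have "\<not> bdd_below (\<Psi> ` {..c - 1})"
  proof (rule unbounded_below_if_deriv_bounded)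
    have radii: "\<Phi> t \<in> radii" if "t \<le> c" for t
      using branch[OF that] time_radius_in_radii by simp
    have "\<Phi> (c - 1) < outer_radius"
      using branch[of "c - 1"] time_radius_less_outer[of "- 1"] by simp
    then show "0 < height_speed (\<Phi> (c - 1))"
      using radii by (intro height_speed_pos) auto
    fix t assume t: "t \<le> c - 1"
    have "\<Phi> t \<le> \<Phi> (c - 1)"
      using strict_mono_on_less_eq[OF radius_time_strict_mono radii radii, of t "c - 1"] t branch
      by (simp add: times)
    then have "height_speed (\<Phi> (c - 1)) \<le> height_speed (\<Phi> t)"
      using radii t radiiD(3) by (intro height_speed_antimono) auto
    with \<Psi>(1) show "\<exists>D\<ge>height_speed (\<Phi> (c - 1)). (\<Psi> has_real_derivative D) (at t)"
      by blast
  qed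
  then have unbounded: "\<not> bdd_below (\<Psi> ` {..c})"
    by (meson bdd_below_mono image_mono atMost_subset_iff diff_le_eq le_add_same_cancel1 zero_le_one)
  show ?thesis
  proof (intro exI conjI)
    show "is_interval {..c}" "I \<subseteq> {..c}"
      using sub by auto
    show "\<not> bdd_below {..c}"
    proof
      assume "bdd_below {..c}"
      then obtain m where "\<And>x. x \<le> c \<Longrightarrow> m \<le> x"
        by (auto simp: bdd_below_def)
      from this[of "min c (m - 1)"] show False by simp
    qed
    show "\<forall>t\<in>I. \<Phi> t = \<phi> t \<and> \<Psi> t = \<psi> t"
      using \<Phi>_I \<Psi>(2) by blast
    show "curvature_solution n K C {..c} \<Phi> (\<lambda>t. radius_speed (\<Phi> t)) \<Psi> (\<lambda>t. height_speed (\<Phi> t))"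
      by (rule curvature_solution_single_branch[OF branch \<Psi>(1)])
    show "inverse_formula n K C 1 {..c} \<Phi>"
      by (rule inverse_formula_time_radius[where c = c]) (use branch in auto)
  qed (rule unbounded)
qed

end

text \<open>At a positive radius the left side of the first integral is negative, while the power on
  the right is nonnegative.\<close>

lemma first_integral_constant_neg:
  assumes K: "K < 0" and n: "3 \<le> n" and sol: "curvature_solution n K C I \<phi> \<phi>' \<psi> \<psi>'"
    and t: "t \<in> I" "\<phi> t \<noteq> 0"
  shows "C < 0"
proof -
  have "0 < \<phi> t" "0 \<le> sqrt (1 - (\<phi>' t)\<^sup>2) ^ (n - 1)"
    "K * \<phi> t ^ (n - 1) = sqrt (1 - (\<phi>' t)\<^sup>2) ^ (n - 1) + C"
  proof -
    have "(\<phi>' t)\<^sup>2 + (\<psi>' t)\<^sup>2 = 1" "0 \<le> \<phi> t"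
      using sol t unfolding curvature_solution_def generating_curve_def by auto
    then have "0 \<le> 1 - (\<phi>' t)\<^sup>2"
      by (metis add_diff_cancel_left' zero_le_power2)
    then show "0 \<le> sqrt (1 - (\<phi>' t)\<^sup>2) ^ (n - 1)" by simp
    show "0 < \<phi> t" using \<open>0 \<le> \<phi> t\<close> t by simp
    show "K * \<phi> t ^ (n - 1) = sqrt (1 - (\<phi>' t)\<^sup>2) ^ (n - 1) + C"
      using sol t unfolding curvature_solution_def first_integral_def by auto
  qed
  moreover from this(1) K have "K * \<phi> t ^ (n - 1) < 0"
    by (intro mult_neg_pos) auto
  ultimately show ?thesis by linarith
qed

theorem theorem3p6:
  fixes n :: nat and K C :: real and I :: "real set"
    and \<phi> \<phi>' \<psi> \<psi>' :: "real \<Rightarrow> real" and k :: "'n::finite"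
  assumes n: "n = CARD('n)" "n \<ge> 3"
    and K: "K < 0"
    and I: "is_interval I" "interior I \<noteq> {}"
    and sol: "curvature_solution n K C I \<phi> \<phi>' \<psi> \<psi>'"
    and nondegenerate: "\<exists>t\<in>I. \<phi> t \<noteq> 0"
  shows
    "(\<forall>J \<sigma>. is_interval J \<and> J \<subseteq> I \<and> \<sigma> \<in> {-1, 1} \<and> (\<forall>t\<in>J. 0 \<le> \<sigma> * \<phi>' t)
        \<longrightarrow> inverse_formula n K C \<sigma> J \<phi>)
   \<and> (C \<noteq> -1 \<longrightarrow>
        (let a = root (n - 1) ((C + 1) / K);
             a\<^sub>0 = root (n - 1) (max 0 ((C + 1) / K));
             b = root (n - 1) (C / K);
             T = quad_time n K C a\<^sub>0 b
         in quad_integrable_between n K C a b \<and> quad_integrable_between n K C a\<^sub>0 b \<and>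
            (\<exists>C' D' \<Phi> \<Phi>' \<Psi> \<Psi>'.
               I \<subseteq> {C'..C' + T} \<union> {D' - T..D'}
             \<and> (\<forall>t\<in>I. \<Phi> t = \<phi> t \<and> \<Psi> t = \<psi> t)
             \<and> curvature_solution n K C ({C'..C' + T} \<union> {D' - T..D'}) \<Phi> \<Phi>' \<Psi> \<Psi>'
             \<and> \<Phi> C' = b \<and> \<Phi> D' = b
             \<and> D' - C' = 2 * quad_time n K C a b
             \<and> inverse_formula n K C (-1) {C'..C' + T} \<Phi>
             \<and> inverse_formula n K C 1 {D' - T..D'} \<Phi>
             \<and> inverse_formula n K C 1 (uminus ` {C'..C' + T}) (\<lambda>t. \<Phi> (- t))
             \<and> inverse_formula n K C (-1) (uminus ` {D' - T..D'}) (\<lambda>t. \<Phi> (- t)))))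
   \<and> (C = -1 \<and> (\<forall>t\<in>I. 0 \<le> \<phi>' t) \<longrightarrow>
        (\<exists>S \<Phi> \<Phi>' \<Psi> \<Psi>'.
            is_interval S \<and> I \<subseteq> S \<and> \<not> bdd_below S
          \<and> (\<forall>t\<in>I. \<Phi> t = \<phi> t \<and> \<Psi> t = \<psi> t)
          \<and> curvature_solution n K C S \<Phi> \<Phi>' \<Psi> \<Psi>'
          \<and> inverse_formula n K C 1 S \<Phi>
          \<and> \<not> compact (rotation_hypersurface k S \<Phi> \<Psi>)
          \<and> \<not> bounded ((\<lambda>x. x $ k) ` rotation_hypersurface k S \<Phi> \<Psi>)))"
proof -
  have card: "2 \<le> CARD('n)"
    using n by simp
  have "C < 0"
    using nondegenerate first_integral_constant_neg[OF K n(2) sol] by blast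
  then interpret negative_curvature_solution n K C I \<phi> \<phi>' \<psi> \<psi>'
    by unfold_locales (use n K I sol nondegenerate in auto)
  let ?a = "root (n - 1) ((C + 1) / K)"
  show ?thesis
    unfolding Let_def inner_radius_def[symmetric] outer_radius_def[symmetric]
  proof (intro conjI impI)
    show "\<forall>J \<sigma>. is_interval J \<and> J \<subseteq> I \<and> \<sigma> \<in> {-1, 1} \<and> (\<forall>t\<in>J. 0 \<le> \<sigma> * \<phi>' t)
        \<longrightarrow> inverse_formula n K C \<sigma> J \<phi>"
      using inverse_formula_curve by blast
  next
    assume C: "C \<noteq> -1"
    then have "inner_radius \<in> radii"
      using inner_less_outer by (simp add: radii_def)
    then show "quad_integrable_between n K C ?a outer_radius"
      "quad_integrable_between n K C inner_radius outer_radius"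
      using quad_integrable_between_outer[OF C refl] quad_integrable_between_radii outer_radius_in_radii
      by blast+
    show "\<exists>C' D' \<Phi> \<Phi>' \<Psi> \<Psi>'.
        I \<subseteq> {C'..C' + quad_time n K C inner_radius outer_radius} \<union>
          {D' - quad_time n K C inner_radius outer_radius..D'}
      \<and> (\<forall>t\<in>I. \<Phi> t = \<phi> t \<and> \<Psi> t = \<psi> t)
      \<and> curvature_solution n K C ({C'..C' + quad_time n K C inner_radius outer_radius} \<union>
          {D' - quad_time n K C inner_radius outer_radius..D'}) \<Phi> \<Phi>' \<Psi> \<Psi>'
      \<and> \<Phi> C' = outer_radius \<and> \<Phi> D' = outer_radius
      \<and> D' - C' = 2 * quad_time n K C ?a outer_radius
      \<and> inverse_formula n K C (-1) {C'..C' + quad_time n K C inner_radius outer_radius} \<Phi>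
      \<and> inverse_formula n K C 1 {D' - quad_time n K C inner_radius outer_radius..D'} \<Phi>
      \<and> inverse_formula n K C 1 (uminus ` {C'..C' + quad_time n K C inner_radius outer_radius})
          (\<lambda>t. \<Phi> (- t))
      \<and> inverse_formula n K C (-1) (uminus ` {D' - quad_time n K C inner_radius outer_radius..D'})
          (\<lambda>t. \<Phi> (- t))"
      \<comment> \<open>This turns the two clauses for the reversed orientation into the two direct
        ones.\<close>
      unfolding inverse_formula_reflect minus_minus
      using two_branch_extension[OF C refl] by metis
  next
    assume "C = -1 \<and> (\<forall>t\<in>I. 0 \<le> \<phi>' t)"
    then have "C = -1" and nonneg: "\<And>t. t \<in> I \<Longrightarrow> 0 \<le> \<phi>' t"
      by blast+
    from unbounded_extension[OF this] show "\<exists>S \<Phi> \<Phi>' \<Psi> \<Psi>'.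
        is_interval S \<and> I \<subseteq> S \<and> \<not> bdd_below S
      \<and> (\<forall>t\<in>I. \<Phi> t = \<phi> t \<and> \<Psi> t = \<psi> t)
      \<and> curvature_solution n K C S \<Phi> \<Phi>' \<Psi> \<Psi>'
      \<and> inverse_formula n K C 1 S \<Phi>
      \<and> \<not> compact (rotation_hypersurface k S \<Phi> \<Psi>)
      \<and> \<not> bounded ((\<lambda>x. x $ k) ` rotation_hypersurface k S \<Phi> \<Psi>)"
      using rotation_hypersurface_unbounded[OF card] by metis
  qed
qed

end
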